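(* Let $d\ge1$ be an integer, let $\phi$ be any gauge, and let $\Omega\subseteq\mathbb{R}^d$ be locally compact. For a typical function $f\in C(\Omega)$, (i) $\underline{\dim}_{\mathsf P}\{\operatorname{lip}_\phi f>0\}\le d-1$. If, moreover, $\Omega$ has nonempty interior and $\phi\succcurlyeq1$ (i.e. $\limsup_{r\to0+}\phi(r)/r<\infty$), then for a typical function $f\in C(\Omega)$ also (ii) $\underline{\dim}_{\mathsf P}\{\operatorname{lip}_\phi f>0\}=\dim_{\mathsf H}\{\operatorname{lip}_\phi f>0\}=d-1$; (iii) $\underline{\dim}_{\mathsf P}\{\operatorname{lip}_\phi f=\infty\}=\dim_{\mathsf H}\{\operatorname{lip}_\phi f=\infty\}=d-1$.
   Context: A gauge is a non-decreasing right-continuous function $\phi\colon[0,\infty)\to[0,\infty)$ with $\phi(0)=0$ and $\phi(r)>0$ for $r>0$. $C(\Omega)$ is the space of continuous real functions on $\Omega$ with the compact-open topology. "For a typical $f$ ... holds" means: there is a comeager set $\mathcal{F}\subseteq C(\Omega)$ such that every $f\in\mathcal{F}$ has the property. Generalized little lip function: $\operatorname{lip}_\phi f(x)=\liminf_{r\to0+}\frac{\operatorname{diam}f(B(x,r))}{\phi(r)}$ for $x\in\Omega$, where $B(x,r)$ is the closed ball in $\Omega$; $\{\operatorname{lip}_\phi f>0\}$ denotes $\{x\in\Omega:\operatorname{lip}_\phi f(x)>0\}$, and similarly for $\{\operatorname{lip}_\phi f=\infty\}$. Lower packing dimension $\underline{\dim}_{\mathsf P}$: for $\delta>0$ let $N_\delta(E)$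 be the least number of sets of diameter at most $\delta$ needed to cover $E$. For $s>0$ let $\boldsymbol{\nu}^s_0(E)=\liminf_{\delta\to0}N_\delta(E)\delta^s$ and $\boldsymbol{\nu}^s(E)=\inf\{\sum_n\boldsymbol{\nu}^s_0(E_n):\{E_n\}\text{ a countable cover of }E\}$. Then $\underline{\dim}_{\mathsf P}E=\sup\{s>0:\boldsymbol{\nu}^s(E)>0\}$ ($\sup\emptyset=0$). $\dim_{\mathsf H}$ is the usual Hausdorff dimension. *)

theory Defs
  imports "HOL-Analysis.Analysis"
begin

section \<open>The compact-open topology and Baire category\<close>

text \<open>A map between topological spaces is represented by its extensional version (constantly
  \<^term>\<open>undefined\<close> off the domain), so that points of the space below correspond bijectively
  to continuous maps from \<open>X\<close> to \<open>Y\<close>.\<close>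

definition compact_open_topology :: "'a topology \<Rightarrow> 'b topology \<Rightarrow> ('a \<Rightarrow> 'b) topology" where
  "compact_open_topology X Y = topology_generated_by
     {{f \<in> extensional (topspace X). continuous_map X Y f \<and> f ` K \<subseteq> U} |K U.
        compactin X K \<and> openin Y U}"

lemma topspace_compact_open_topology:
  "topspace (compact_open_topology X Y) = {f \<in> extensional (topspace X). continuous_map X Y f}"
proof -
  have "compactin X {}" "openin Y {}"
    by simp_all
  then have "{f \<in> extensional (topspace X). continuous_map X Y f}
      \<in> {{f \<in> extensional (topspace X). continuous_map X Y f \<and> f ` K \<subseteq> U} |K U.
            compactin X K \<and> openin Y U}"
    by (auto intro!: exI[where x="{}"])
  then show ?thesis
    unfolding compact_open_topology_def topology_generated_by_topspace
    by (intro equalityI) auto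
qed

abbreviation cont_funs :: "'a::topological_space set \<Rightarrow> ('a \<Rightarrow> real) topology" where
  "cont_funs \<Omega> \<equiv> compact_open_topology (top_of_set \<Omega>) euclideanreal"

definition nowhere_dense_in :: "'a topology \<Rightarrow> 'a set \<Rightarrow> bool" where
  "nowhere_dense_in X S \<longleftrightarrow> S \<subseteq> topspace X \<and> X interior_of (X closure_of S) = {}"

definition meager_in :: "'a topology \<Rightarrow> 'a set \<Rightarrow> bool" where
  "meager_in X S \<longleftrightarrow> (\<exists>\<N>. countable \<N> \<and> (\<forall>N\<in>\<N>. nowhere_dense_in X N) \<and> S = \<Union>\<N>)"

definition comeager_in :: "'a topology \<Rightarrow> 'a set \<Rightarrow> bool" where
  "comeager_in X S \<longleftrightarrow> S \<subseteq> topspace X \<and> meager_in X (topspace X - S)"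

definition typically_in :: "'a topology \<Rightarrow> ('a \<Rightarrow> bool) \<Rightarrow> bool" where
  "typically_in X P \<longleftrightarrow> (\<exists>\<F>. comeager_in X \<F> \<and> (\<forall>f\<in>\<F>. P f))"


section \<open>Gauges and the generalized little lip function\<close>

text \<open>Only the values on \<open>[0,\<infinity>)\<close> matter. The name \<open>gauge\<close> is taken by the
  Henstock--Kurzweil integral.\<close>

definition gauge_function :: "(real \<Rightarrow> real) \<Rightarrow> bool" where
  "gauge_function \<phi> \<longleftrightarrow>
     mono_on {0..} \<phi> \<and> (\<forall>r\<ge>0. continuous (at_right r) \<phi>) \<and> \<phi> 0 = 0 \<and> (\<forall>r>0. \<phi> r > 0)"

text \<open>\<^term>\<open>diameter\<close> is real-valued and meaningful only for bounded sets. For locally compact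
  \<open>\<Omega>\<close> and \<open>f\<close> continuous on \<open>\<Omega>\<close> the images below are bounded for all small \<open>r\<close>, and the
  limit inferior depends on these only.\<close>

definition little_lip ::
    "(real \<Rightarrow> real) \<Rightarrow> 'a::metric_space set \<Rightarrow> ('a \<Rightarrow> real) \<Rightarrow> 'a \<Rightarrow> ereal" where
  "little_lip \<phi> \<Omega> f x =
     Liminf (at_right 0) (\<lambda>r. ereal (diameter (f ` (cball x r \<inter> \<Omega>)) / \<phi> r))"


section \<open>Lower packing dimension and Hausdorff dimension\<close>

definition covering_number :: "real \<Rightarrow> 'a::metric_space set \<Rightarrow> enat" where
  "covering_number \<delta> E =
     (INF \<U> \<in> {\<U>. finite \<U> \<and> (\<forall>U\<in>\<U>. bounded U \<and> diameter U \<le> \<delta>) \<and> E \<subseteq> \<Union>\<U>}. enat (card \<U>))"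

definition lower_box_premeasure :: "real \<Rightarrow> 'a::metric_space set \<Rightarrow> ennreal" where
  "lower_box_premeasure s E =
     Liminf (at_right 0) (\<lambda>\<delta>. ennreal_of_enat (covering_number \<delta> E) * ennreal (\<delta> powr s))"

definition lower_packing_measure :: "real \<Rightarrow> 'a::metric_space set \<Rightarrow> ennreal" where
  "lower_packing_measure s E =
     (INF A \<in> {A :: nat \<Rightarrow> 'a set. E \<subseteq> (\<Union>n. A n)}. \<Sum>n. lower_box_premeasure s (A n))"

text \<open>In \<^typ>\<open>ennreal\<close> the supremum of the empty set is \<open>0\<close>.\<close>

definition lower_packing_dim :: "'a::metric_space set \<Rightarrow> ennreal" where
  "lower_packing_dim E = Sup {ennreal s |s. s > 0 \<and> lower_packing_measure s E > 0}"

definition hausdorff_premeasure :: "real \<Rightarrow> real \<Rightarrow> 'a::metric_space set \<Rightarrow> ennreal" where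
  "hausdorff_premeasure s \<delta> E =
     (INF A \<in> {A :: nat \<Rightarrow> 'a set. (\<forall>n. bounded (A n) \<and> diameter (A n) \<le> \<delta>) \<and> E \<subseteq> (\<Union>n. A n)}.
        \<Sum>n. ennreal (diameter (A n) powr s))"

definition hausdorff_measure :: "real \<Rightarrow> 'a::metric_space set \<Rightarrow> ennreal" where
  "hausdorff_measure s E = (SUP \<delta>\<in>{0<..}. hausdorff_premeasure s \<delta> E)"

definition hausdorff_dim :: "'a::metric_space set \<Rightarrow> ennreal" where
  "hausdorff_dim E = Sup {ennreal s |s. s > 0 \<and> hausdorff_measure s E > 0}"

end

(* Upper bound: a continuous function is approximated on compact sets by functions that are constant
on the cells of a fine grid, away from an arbitrarily thin neighbourhood of the grid. Any function
close enough to such an approximation oscillates by less than \<phi>(r)/n on balls of one suitable small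
radius r, except at centres in a thin neighbourhood of the grid, which is covered by
O(q^(d-1)) cubes of side 1/q. For a typical f this happens at arbitrarily small scales, so the set
where the little lip function is positive is a countable union of sets whose lower box-counting
premeasures of every order s > d - 1 vanish.

Lower bound: fix a cube and the segments crossing it in one coordinate direction. Adding a small
cosine of high frequency in that direction creates, on every segment simultaneously, short
subintervals of prescribed mean slope; the subinterval can be placed so that, if the mean slope of the
given interval was at least n, the oscillation is at least (n/4) r at all intermediate radii r.
For a typical f one can therefore choose nested intervals on each of the segments, shrinking to a
point where the little lip function for the gauge r, hence for any gauge bounded by C r, is infinite.
So the shadow of the set of these points on a (d-1)-dimensional cube is everything, and its
(d-1)-dimensional Hausdorff measure is positive. *)
theory Submission
  imports Defs
begin

section \<open>Typical continuous functions\<close>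

lemma topspace_cont_funs:
  "topspace (cont_funs \<Omega>) = {f \<in> extensional \<Omega>. continuous_on \<Omega> f}"
  by (simp add: topspace_compact_open_topology)

lemma openin_cont_funs_subbasic:
  assumes "compact K" "K \<subseteq> \<Omega>" "open U"
  shows "openin (cont_funs \<Omega>) {f \<in> topspace (cont_funs \<Omega>). f ` K \<subseteq> U}"
  unfolding topspace_compact_open_topology unfolding compact_open_topology_def
  by (rule topology_generated_by_Basis)
    (use assms in \<open>auto simp: compactin_subtopology intro!: exI[of _ K] exI[of _ U]\<close>)

text \<open>Finitely many balls of radius \<eta>/3 cover the compact image of \<open>K\<close>. The
  preimages in \<open>K\<close> of the closed balls are compact, and forcing \<open>h\<close> to map
  each of them into the concentric ball of radius \<eta>/2 is a finite list of subbasic conditions,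
  which keeps \<open>h\<close> within 5\<eta>/6 of \<open>f\<close> on \<open>K\<close>.\<close>

lemma uniform_ball_nbhd_cont_funs:
  fixes \<Omega> :: "'a::metric_space set"
  assumes f: "continuous_on \<Omega> f" and fe: "f \<in> extensional \<Omega>"
    and K: "compact K" "K \<subseteq> \<Omega>" and "\<eta> > 0"
  obtains V where "openin (cont_funs \<Omega>) V" "f \<in> V" "\<And>h x. h \<in> V \<Longrightarrow> x \<in> K \<Longrightarrow> \<bar>h x - f x\<bar> < \<eta>"
proof -
  have fK: "continuous_on K f"
    using f K(2) continuous_on_subset by blast
  have "compact (f ` K)"
    using K fK by (rule_tac compact_continuous_image)
  then obtain Y where Y: "finite Y" "Y \<subseteq> f ` K" "f ` K \<subseteq> (\<Union>y\<in>Y. ball y (\<eta>/3))"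
    using compactE_image[of "f ` K" "f ` K" "\<lambda>y. ball y (\<eta>/3)"] \<open>\<eta> > 0\<close> by force
  define L where "L y = K \<inter> f -` cball y (\<eta>/3)" for y
  have L: "compact (L y)" "L y \<subseteq> \<Omega>" for y
  proof -
    have "closed (L y)"
      unfolding L_def by (rule continuous_closed_preimage[OF fK compact_imp_closed[OF K(1)] closed_cball])
    then show "compact (L y)"
      using compact_Int_closed[OF K(1), of "L y"] by (simp add: L_def)
  qed (use K L_def in auto)
  \<comment> \<open>If \<open>K\<close> is empty then so is \<open>Y\<close>, and the factor
    \<open>topspace\<close> keeps the intersection inside the space.\<close>
  define V where "V = topspace (cont_funs \<Omega>) \<inter>
    (\<Inter>y\<in>Y. {h \<in> topspace (cont_funs \<Omega>). h ` L y \<subseteq> ball y (\<eta>/2)})"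
  show thesis
  proof
    show "openin (cont_funs \<Omega>) V"
      unfolding V_def
      by (rule openin_Int_Inter)
        (use Y(1) L in \<open>auto intro!: openin_cont_funs_subbasic\<close>)
    show "f \<in> V"
      using \<open>\<eta> > 0\<close> f fe unfolding V_def topspace_cont_funs L_def by (auto simp: dist_real_def)
    fix h x assume h: "h \<in> V" and x: "x \<in> K"
    then obtain y where y: "y \<in> Y" "f x \<in> ball y (\<eta>/3)"
      using Y(3) by blast
    then have "x \<in> L y"
      using x by (auto simp: L_def)
    then have "h x \<in> ball y (\<eta>/2)"
      using h y(1) unfolding V_def by blast
    then show "\<bar>h x - f x\<bar> < \<eta>"
      using y(2) \<open>\<eta> > 0\<close> unfolding mem_ball dist_real_def by linarith
  qed
qed

text \<open>Induction on the generation of the topology: an intersection joins the compact sets and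
  takes the smaller tolerance; for a subbasic set, the compact image of \<open>K\<close> has a
  uniform ball neighbourhood inside \<open>U\<close>.\<close>

lemma cont_funs_nbhd_uniform:
  fixes \<Omega> :: "'a::metric_space set"
  assumes "openin (cont_funs \<Omega>) W" "f \<in> W"
  shows "\<exists>K \<epsilon>. compact K \<and> K \<subseteq> \<Omega> \<and> \<epsilon> > 0 \<and>
    (\<forall>g \<in> topspace (cont_funs \<Omega>). (\<forall>x\<in>K. \<bar>g x - f x\<bar> < \<epsilon>) \<longrightarrow> g \<in> W)"
proof -
  let ?\<B> = "{{f \<in> extensional (topspace (top_of_set \<Omega>)).
     continuous_map (top_of_set \<Omega>) euclideanreal f \<and> f ` K \<subseteq> U} |K U.
        compactin (top_of_set \<Omega>) K \<and> openin euclideanreal U}"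
  have "generate_topology_on ?\<B> W"
    using assms(1) unfolding compact_open_topology_def openin_topology_generated_by_iff .
  then show ?thesis
    using assms(2)
  proof (induction)
    case (Int A B)
    then obtain K \<epsilon> L \<delta> where
      "compact K" "K \<subseteq> \<Omega>" "\<epsilon> > 0" "\<forall>g\<in>topspace (cont_funs \<Omega>). (\<forall>x\<in>K. \<bar>g x - f x\<bar> < \<epsilon>) \<longrightarrow> g \<in> A"
      "compact L" "L \<subseteq> \<Omega>" "\<delta> > 0" "\<forall>g\<in>topspace (cont_funs \<Omega>). (\<forall>x\<in>L. \<bar>g x - f x\<bar> < \<delta>) \<longrightarrow> g \<in> B"
      using Int(3)[OF IntD1[OF Int(5)]] Int(4)[OF IntD2[OF Int(5)]] by blast
    then show ?case
      by (intro exI[of _ "K \<union> L"] exI[of _ "min \<epsilon> \<delta>"]) auto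
  next
    case (UN \<K>)
    then obtain S where S: "S \<in> \<K>" "f \<in> S"
      by blast
    then obtain K \<epsilon> where "compact K" "K \<subseteq> \<Omega>" "\<epsilon> > 0"
      "\<forall>g\<in>topspace (cont_funs \<Omega>). (\<forall>x\<in>K. \<bar>g x - f x\<bar> < \<epsilon>) \<longrightarrow> g \<in> S"
      using UN(2)[OF S] by blast
    then show ?case
      using S(1) by (intro exI[of _ K] exI[of _ \<epsilon>]) auto
  next
    case (Basis S)
    then obtain K U where S: "S = {f \<in> topspace (cont_funs \<Omega>). f ` K \<subseteq> U}"
      and K: "compact K" "K \<subseteq> \<Omega>" and U: "open U"
      unfolding topspace_compact_open_topology by (auto simp: compactin_subtopology)
    have f: "continuous_on \<Omega> f" "f ` K \<subseteq> U"
      using Basis(2) unfolding S topspace_cont_funs by auto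
    have "compact (f ` K)"
      using K f(1) continuous_on_subset compact_continuous_image by metis
    then obtain e where e: "e > 0" "(\<Union>y\<in>f ` K. ball y e) \<subseteq> U"
      using compact_subset_open_imp_ball_epsilon_subset U f(2) by metis
    show ?case
    proof (intro exI conjI ballI impI)
      fix g assume g: "g \<in> topspace (cont_funs \<Omega>)" "\<forall>x\<in>K. \<bar>g x - f x\<bar> < e"
      have "g x \<in> U" if "x \<in> K" for x
      proof -
        have "g x \<in> ball (f x) e"
          using g(2) that by (auto simp: dist_real_def abs_minus_commute)
        then show ?thesis
          using e(2) that by blast
      qed
      then show "g \<in> S"
        using g(1) by (auto simp: S)
    qed (use K e in auto)
  qed auto
qed

section \<open>A density criterion for typicality\<close>

lemma nowhere_dense_inI:
  assumes "S \<subseteq> topspace X"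
    and "\<And>W. openin X W \<Longrightarrow> W \<noteq> {} \<Longrightarrow> \<exists>V. openin X V \<and> V \<noteq> {} \<and> V \<subseteq> W - S"
  shows "nowhere_dense_in X S"
  unfolding nowhere_dense_in_def
proof (rule conjI[OF assms(1)], rule ccontr)
  let ?W = "X interior_of (X closure_of S)"
  assume "?W \<noteq> {}"
  then obtain V where V: "openin X V" "V \<noteq> {}" "V \<subseteq> ?W - S"
    using assms(2)[of ?W] by auto
  \<comment> \<open>An open set disjoint from \<open>S\<close> is disjoint from its closure, but
    \<open>V\<close> lies inside that closure.\<close>
  then have "V \<inter> X closure_of S = {}"
    using openin_Int_closure_of_eq_empty[of X V S] by auto
  then show False
    using V interior_of_subset[of X "X closure_of S"] by blast
qed

text \<open>Both bounds enter through this criterion. Each \<open>P i\<close> is to hold on a whole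
  uniform neighbourhood of some \<open>g\<close> approximating a given \<open>f\<close>, so the
  functions violating \<open>P i\<close> form a nowhere dense set, and countably many indices leave
  a comeager set. The premises speak of arbitrary continuous functions, so that applications need
  not deal with extensionality.\<close>

lemma typically_in_cont_funsI:
  fixes \<Omega> :: "'a::metric_space set"
  assumes "countable I"
    and dense: "\<And>i f K \<epsilon>. i \<in> I \<Longrightarrow> continuous_on \<Omega> f \<Longrightarrow> compact K \<Longrightarrow> K \<subseteq> \<Omega> \<Longrightarrow> \<epsilon> > 0 \<Longrightarrow>
      \<exists>g K' \<eta>. continuous_on \<Omega> g \<and> (\<forall>x\<in>K. \<bar>g x - f x\<bar> < \<epsilon>) \<and> compact K' \<and> K' \<subseteq> \<Omega> \<and> \<eta> > 0 \<and>
        (\<forall>h. continuous_on \<Omega> h \<longrightarrow> (\<forall>x\<in>K'. \<bar>h x - g x\<bar> < \<eta>) \<longrightarrow> P i h)"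
    and Q: "\<And>h. continuous_on \<Omega> h \<Longrightarrow> (\<And>i. i \<in> I \<Longrightarrow> P i h) \<Longrightarrow> Q h"
  shows "typically_in (cont_funs \<Omega>) Q"
proof -
  let ?X = "cont_funs \<Omega>"
  define N where "N i = {h \<in> topspace ?X. \<not> P i h}" for i
  have N: "nowhere_dense_in ?X (N i)" if i: "i \<in> I" for i
  proof (rule nowhere_dense_inI)
    fix W assume W: "openin ?X W" "W \<noteq> {}"
    then obtain f where f: "f \<in> W" "continuous_on \<Omega> f"
      using openin_subset topspace_cont_funs by fastforce
    then obtain K \<epsilon> where K: "compact K" "K \<subseteq> \<Omega>" "\<epsilon> > 0"
      "\<forall>g \<in> topspace ?X. (\<forall>x\<in>K. \<bar>g x - f x\<bar> < \<epsilon>) \<longrightarrow> g \<in> W"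
      using cont_funs_nbhd_uniform[OF W(1) f(1)] by blast
    then obtain g K' \<eta> where g: "continuous_on \<Omega> g" "\<forall>x\<in>K. \<bar>g x - f x\<bar> < \<epsilon>"
      "compact K'" "K' \<subseteq> \<Omega>" "\<eta> > 0"
      "\<forall>h. continuous_on \<Omega> h \<longrightarrow> (\<forall>x\<in>K'. \<bar>h x - g x\<bar> < \<eta>) \<longrightarrow> P i h"
      using dense[OF i f(2) K(1-3)] by blast
    \<comment> \<open>Points of the function space are extensional; restricting changes nothing on
      \<open>K\<close> and \<open>K'\<close>, which lie in \<Omega>.\<close>
    define g' where "g' = restrict g \<Omega>"
    have g': "continuous_on \<Omega> g'" "g' \<in> extensional \<Omega>"
      using g(1) by (auto simp: g'_def cong: continuous_on_cong)
    have "g' \<in> W"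
      using K(2,4) g(2) g' by (auto simp: topspace_cont_funs g'_def subset_iff)
    obtain V where V: "openin ?X V" "g' \<in> V" "\<And>h x. h \<in> V \<Longrightarrow> x \<in> K' \<Longrightarrow> \<bar>h x - g' x\<bar> < \<eta>"
      using uniform_ball_nbhd_cont_funs[OF g' g(3-5)] by blast
    have "P i h" if "h \<in> V" for h
    proof -
      have "continuous_on \<Omega> h"
        using that V(1) openin_subset topspace_cont_funs by fastforce
      moreover have "\<bar>h x - g x\<bar> < \<eta>" if "x \<in> K'" for x
        using V(3)[OF \<open>h \<in> V\<close> that] g(4) that by (auto simp: g'_def)
      ultimately show ?thesis
        using g(6) by blast
    qed
    then have "V \<inter> W \<subseteq> W - N i"
      by (auto simp: N_def)
    then show "\<exists>V. openin ?X V \<and> V \<noteq> {} \<and> V \<subseteq> W - N i"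
      using V(1,2) W(1) \<open>g' \<in> W\<close> by blast
  qed (auto simp: N_def)
  let ?F = "topspace ?X - (\<Union>i\<in>I. N i)"
  have "comeager_in ?X ?F"
    unfolding comeager_in_def meager_in_def
  proof (intro conjI exI[of _ "N ` I"])
    show "topspace ?X - ?F = \<Union> (N ` I)"
      by (auto simp: N_def)
  qed (use assms(1) N in auto)
  moreover have "Q h" if "h \<in> ?F" for h
    using that by (intro Q) (auto simp: N_def topspace_cont_funs)
  ultimately show ?thesis
    unfolding typically_in_def by blast
qed

lemma typically_in_conj:
  assumes "typically_in X P" "typically_in X Q"
  shows "typically_in X (\<lambda>f. P f \<and> Q f)"
proof -
  obtain F G M N where F: "F \<subseteq> topspace X" "countable M" "\<forall>S\<in>M. nowhere_dense_in X S" "topspace X - F = \<Union>M" "\<forall>f\<in>F. P f"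
    and G: "G \<subseteq> topspace X" "countable N" "\<forall>S\<in>N. nowhere_dense_in X S" "topspace X - G = \<Union>N" "\<forall>f\<in>G. Q f"
    using assms unfolding typically_in_def comeager_in_def meager_in_def by metis
  have "comeager_in X (F \<inter> G)"
    unfolding comeager_in_def meager_in_def
  proof (intro conjI exI[of _ "M \<union> N"])
    show "topspace X - F \<inter> G = \<Union> (M \<union> N)"
      using F(4) G(4) by blast
  qed (use F G in auto)
  then show ?thesis
    unfolding typically_in_def using F(5) G(5) by blast
qed

lemma typically_in_mono:
  assumes "typically_in X P" "\<And>f. P f \<Longrightarrow> Q f"
  shows "typically_in X Q"
  using assms unfolding typically_in_def by blast

section \<open>Hausdorff and lower packing dimension\<close>

lemma hausdorff_premeasure_mono:
  "E \<subseteq> F \<Longrightarrow> hausdorff_premeasure s \<delta> E \<le> hausdorff_premeasure s \<delta> F"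
  unfolding hausdorff_premeasure_def by (rule INF_superset_mono) auto

lemma hausdorff_measure_mono: "E \<subseteq> F \<Longrightarrow> hausdorff_measure s E \<le> hausdorff_measure s F"
  unfolding hausdorff_measure_def by (intro SUP_mono') (rule hausdorff_premeasure_mono)

lemma hausdorff_dim_mono:
  assumes "E \<subseteq> F"
  shows "hausdorff_dim E \<le> hausdorff_dim F"
  unfolding hausdorff_dim_def
  by (rule Sup_subset_mono) (use hausdorff_measure_mono[OF assms] in \<open>blast intro: less_le_trans\<close>)

lemma lower_packing_measure_mono:
  "E \<subseteq> F \<Longrightarrow> lower_packing_measure s E \<le> lower_packing_measure s F"
  unfolding lower_packing_measure_def by (rule INF_superset_mono) auto

lemma lower_packing_dim_mono:
  assumes "E \<subseteq> F"
  shows "lower_packing_dim E \<le> lower_packing_dim F"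
  unfolding lower_packing_dim_def
  by (rule Sup_subset_mono) (use lower_packing_measure_mono[OF assms] in \<open>blast intro: less_le_trans\<close>)

lemma covering_number_le_card:
  assumes "finite \<U>" "\<And>U. U \<in> \<U> \<Longrightarrow> bounded U \<and> diameter U \<le> \<delta>" "E \<subseteq> \<Union>\<U>"
  shows "covering_number \<delta> E \<le> enat (card \<U>)"
  unfolding covering_number_def by (rule INF_lower) (use assms in auto)

lemma covering_number_mono: "E \<subseteq> F \<Longrightarrow> covering_number \<delta> E \<le> covering_number \<delta> F"
  unfolding covering_number_def by (rule INF_superset_mono) auto

text \<open>A finite value rules out an empty family of covers, and the well-order of
  \<open>enat\<close> turns the infimum into a minimum.\<close>

lemma covering_number_attained:
  assumes "covering_number \<delta> E \<noteq> \<infinity>"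
  obtains \<U> where "finite \<U>" "\<forall>U\<in>\<U>. bounded U \<and> diameter U \<le> \<delta>" "E \<subseteq> \<Union>\<U>"
    "covering_number \<delta> E = enat (card \<U>)"
proof -
  let ?S = "{\<U>. finite \<U> \<and> (\<forall>U\<in>\<U>. bounded U \<and> diameter U \<le> \<delta>) \<and> E \<subseteq> \<Union>\<U>}"
  have "?S \<noteq> {}"
  proof
    assume e: "?S = {}"
    have "covering_number \<delta> E = \<infinity>"
      unfolding covering_number_def e by (simp add: top_enat_def)
    with assms show False ..
  qed
  then obtain \<V> where "\<V> \<in> ?S"
    by blast
  then have "covering_number \<delta> E \<in> (\<lambda>\<U>. enat (card \<U>)) ` ?S"
    unfolding covering_number_def by (intro wellorder_InfI) (rule imageI)
  then obtain \<U> where "\<U> \<in> ?S" "covering_number \<delta> E = enat (card \<U>)"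
    by (rule imageE)
  then show thesis
    by (intro that[of \<U>]) auto
qed

lemma hausdorff_premeasure_le_finite_cover:
  assumes "finite \<U>" "\<forall>U\<in>\<U>. bounded U \<and> diameter U \<le> \<rho>" "E \<subseteq> \<Union>\<U>"
    and "0 < \<rho>" "\<rho> \<le> \<delta>" "s > 0"
  shows "hausdorff_premeasure s \<delta> E \<le> of_nat (card \<U>) * ennreal (\<rho> powr s)"
proof -
  obtain e where e: "bij_betw e {..<card \<U>} \<U>"
    using ex_bij_betw_nat_finite[OF assms(1)] by (auto simp: atLeast0LessThan)
  \<comment> \<open>Padding by empty sets costs nothing, since \<open>diameter {} = 0\<close> and
    \<open>0 powr s = 0\<close>.\<close>
  define A where "A n = (if n < card \<U> then e n else {})" for n
  have eU: "e n \<in> \<U>" if "n < card \<U>" for n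
    using e that by (auto simp: bij_betw_def)
  have "hausdorff_premeasure s \<delta> E \<le> (\<Sum>n. ennreal (diameter (A n) powr s))"
    unfolding hausdorff_premeasure_def
  proof (rule INF_lower, safe)
    show "bounded (A n)" "diameter (A n) \<le> \<delta>" for n
      using bspec[OF assms(2) eU[of n]] assms(4,5) by (auto simp: A_def)
    fix x assume "x \<in> E"
    then obtain U where "U \<in> \<U>" "x \<in> U"
      using assms(3) by blast
    then obtain n where "n < card \<U>" "x \<in> e n"
      using bij_betw_imp_surj_on[OF e] by (metis imageE lessThan_iff)
    then show "x \<in> (\<Union>n. A n)"
      by (auto simp: A_def)
  qed
  also have "\<dots> = (\<Sum>n<card \<U>. ennreal (diameter (A n) powr s))"
    by (rule suminf_finite) (auto simp: A_def)
  also have "\<dots> \<le> (\<Sum>n<card \<U>. ennreal (\<rho> powr s))"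
  proof (intro sum_mono ennreal_leI powr_mono2)
    fix n assume "n \<in> {..<card \<U>}"
    then show "diameter (A n) \<le> \<rho>" "0 \<le> diameter (A n)"
      using bspec[OF assms(2) eU[of n]] by (auto simp: A_def diameter_ge_0)
  qed (use \<open>s > 0\<close> in auto)
  finally show ?thesis
    by simp
qed

text \<open>For every \<rho> < \<delta> an optimal cover by sets of diameter at most \<rho> competes
  in the Hausdorff premeasure at scale \<delta>, so the bound holds for every such term of the lower
  limit.\<close>

lemma hausdorff_premeasure_le_lower_box_premeasure:
  assumes "\<delta> > 0" "s > 0"
  shows "hausdorff_premeasure s \<delta> E \<le> lower_box_premeasure s E"
  unfolding lower_box_premeasure_def
proof (rule Liminf_bounded)
  have "hausdorff_premeasure s \<delta> E \<le> ennreal_of_enat (covering_number \<rho> E) * ennreal (\<rho> powr s)"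
    if "0 < \<rho>" "\<rho> < \<delta>" for \<rho>
  proof (cases "covering_number \<rho> E = \<infinity>")
    \<comment> \<open>Without a finite cover the right-hand side is infinite, because
      \<open>\<rho> powr s\<close> is positive.\<close>
    case True
    then show ?thesis
      using that by (simp add: ennreal_top_mult)
  next
    case False
    then obtain \<U> where U: "finite \<U>" "\<forall>U\<in>\<U>. bounded U \<and> diameter U \<le> \<rho>" "E \<subseteq> \<Union>\<U>"
      "covering_number \<rho> E = enat (card \<U>)"
      by (rule covering_number_attained)
    show ?thesis
      using hausdorff_premeasure_le_finite_cover[OF U(1-3)] that assms U(4) by simp
  qed
  then show "\<forall>\<^sub>F \<rho> in at_right 0.
      hausdorff_premeasure s \<delta> E \<le> ennreal_of_enat (covering_number \<rho> E) * ennreal (\<rho> powr s)"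
    using assms(1) by (auto simp: eventually_at_right_field)
qed

lemma hausdorff_premeasure_countably_subadditive:
  assumes "E \<subseteq> (\<Union>n. A n)"
  shows "hausdorff_premeasure s \<delta> E \<le> (\<Sum>n::nat. hausdorff_premeasure s \<delta> (A n))"
proof (cases "(\<Sum>n. hausdorff_premeasure s \<delta> (A n)) = top")
  case False
  have fin: "hausdorff_premeasure s \<delta> (A n) < top" for n
    using False ennreal_suminf_lessD less_top by blast
  show ?thesis
  proof (rule ennreal_le_epsilon)
    fix \<epsilon> :: real assume "\<epsilon> > 0"
    \<comment> \<open>The geometric error budget: a near-optimal cover of \<open>A n\<close> may
      waste \<epsilon>/2^(n+1), in total \<epsilon>.\<close>
    define w where "w n = ennreal (\<epsilon> * (1/2) ^ Suc n)" for n
    have w: "(\<Sum>n. w n) = ennreal \<epsilon>"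
      unfolding w_def
      using \<open>\<epsilon> > 0\<close> sums_mult[OF power_half_series, of \<epsilon>]
      by (intro suminf_ennreal_eq) auto
    have "\<exists>B::nat \<Rightarrow> 'a set. (\<forall>k. bounded (B k) \<and> diameter (B k) \<le> \<delta>) \<and> A n \<subseteq> (\<Union>k. B k) \<and>
        (\<Sum>k. ennreal (diameter (B k) powr s)) \<le> hausdorff_premeasure s \<delta> (A n) + w n" for n
    proof -
      \<comment> \<open>Strictness needs a finite premeasure, which is why the case of an infinite
        sum was split off.\<close>
      have "hausdorff_premeasure s \<delta> (A n) < hausdorff_premeasure s \<delta> (A n) + w n"
        using fin[of n] \<open>\<epsilon> > 0\<close> by (simp add: w_def ennreal_add_left_cancel_less)
      then show ?thesis
        unfolding hausdorff_premeasure_def[of s \<delta> "A n"] INF_less_iff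
        by (auto intro: less_imp_le)
    qed
    then obtain B :: "nat \<Rightarrow> nat \<Rightarrow> 'a set" where
      B: "\<And>n k. bounded (B n k) \<and> diameter (B n k) \<le> \<delta>" "\<And>n. A n \<subseteq> (\<Union>k. B n k)"
      "\<And>n. (\<Sum>k. ennreal (diameter (B n k) powr s)) \<le> hausdorff_premeasure s \<delta> (A n) + w n"
      by metis
    define C where "C i = (case prod_decode i of (n, k) \<Rightarrow> B n k)" for i
    have "hausdorff_premeasure s \<delta> E \<le> (\<Sum>i. ennreal (diameter (C i) powr s))"
      unfolding hausdorff_premeasure_def
    proof (rule INF_lower, safe)
      fix x assume "x \<in> E"
      then obtain n k where "x \<in> B n k"
        using assms B(2) by blast
      then have "x \<in> C (prod_encode (n, k))"
        by (simp add: C_def)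
      then show "x \<in> (\<Union>i. C i)"
        by blast
    qed (use B(1) in \<open>auto simp: C_def split: prod.split\<close>)
    also have "\<dots> = (\<Sum>i. (\<lambda>(n, k). ennreal (diameter (B n k) powr s)) (prod_decode i))"
      by (simp add: C_def split_def)
    also have "\<dots> = (\<Sum>n. \<Sum>k. ennreal (diameter (B n k) powr s))"
      by (rule suminf_ennreal_2dimen) simp
    also have "\<dots> \<le> (\<Sum>n. hausdorff_premeasure s \<delta> (A n) + w n)"
      by (intro suminf_le B(3)) auto
    also have "\<dots> = (\<Sum>n. hausdorff_premeasure s \<delta> (A n)) + ennreal \<epsilon>"
      unfolding w[symmetric] by (rule suminf_add[symmetric]) auto
    finally show "hausdorff_premeasure s \<delta> E \<le> (\<Sum>n. hausdorff_premeasure s \<delta> (A n)) + ennreal \<epsilon>" .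
  qed
qed simp

text \<open>Hausdorff premeasures are already countably subadditive, so the comparison with the
  lower box premeasure survives the passage to countable covers.\<close>

lemma hausdorff_measure_le_lower_packing_measure:
  assumes "s > 0"
  shows "hausdorff_measure s E \<le> lower_packing_measure s E"
  unfolding hausdorff_measure_def lower_packing_measure_def
proof (intro SUP_least INF_greatest)
  fix \<delta> :: real and A :: "nat \<Rightarrow> 'a set"
  assume "\<delta> \<in> {0<..}" and A: "A \<in> {A. E \<subseteq> (\<Union>n. A n)}"
  have "hausdorff_premeasure s \<delta> E \<le> (\<Sum>n. hausdorff_premeasure s \<delta> (A n))"
    using A by (intro hausdorff_premeasure_countably_subadditive) simp
  also have "\<dots> \<le> (\<Sum>n. lower_box_premeasure s (A n))"
    using \<open>\<delta> \<in> {0<..}\<close> assms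
    by (intro suminf_le hausdorff_premeasure_le_lower_box_premeasure) auto
  finally show "hausdorff_premeasure s \<delta> E \<le> (\<Sum>n. lower_box_premeasure s (A n))" .
qed

lemma hausdorff_dim_le_lower_packing_dim: "hausdorff_dim E \<le> lower_packing_dim E"
  unfolding hausdorff_dim_def lower_packing_dim_def
  by (rule Sup_subset_mono)
    (use hausdorff_measure_le_lower_packing_measure in \<open>blast intro: less_le_trans\<close>)

section \<open>Bounding the two dimensions; Hausdorff measure of a set with full shadow\<close>

lemma lower_packing_dim_le:
  assumes "\<And>s. s > real d \<Longrightarrow> lower_packing_measure s E = 0"
  shows "lower_packing_dim E \<le> of_nat d"
  unfolding lower_packing_dim_def
proof (rule Sup_least, safe)
  fix s :: real assume "s > 0" "lower_packing_measure s E > 0"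
  then have "s \<le> real d"
    using assms[of s] by force
  then show "ennreal s \<le> of_nat d"
    by (simp add: ennreal_leI flip: ennreal_of_nat_eq_real_of_nat)
qed

text \<open>Positive measure is demanded only for s > 0, so on the line, where the target is 0,
  nothing has to be shown.\<close>

lemma hausdorff_dim_ge:
  assumes "s \<ge> 0" "s > 0 \<Longrightarrow> hausdorff_measure s E > 0"
  shows "ennreal s \<le> hausdorff_dim E"
proof (cases "s = 0")
  case False
  then show ?thesis
    unfolding hausdorff_dim_def by (intro Sup_upper) (use assms in auto)
qed simp

text \<open>This volume is needed twice: for thickened covering sets and, with \<delta> = \<rho>/2,
  for the cube itself.\<close>

lemma emeasure_lborel_slab:
  fixes c y :: "real ^ 'd" and \<delta> \<rho> :: real
  assumes "\<delta> \<ge> 0" "\<rho> \<ge> 0"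
  shows "emeasure lborel (cbox (\<chi> i. if i = i\<^sub>0 then c $ i else y $ i - \<delta>) (\<chi> i. if i = i\<^sub>0 then c $ i + \<rho> else y $ i + \<delta>))
    = ennreal (\<rho> * (2 * \<delta>) ^ (CARD('d) - 1))" (is "emeasure lborel ?B = _")
proof -
  have ne: "?B \<noteq> {}"
    using assms by (simp add: interval_ne_empty_cart)
  have "measure lborel ?B = (\<Prod>i\<in>(UNIV :: 'd set). if i = i\<^sub>0 then \<rho> else 2 * \<delta>)"
    unfolding content_cbox_cart[OF ne] by (rule prod.cong) auto
  also have "\<dots> = \<rho> * (2 * \<delta>) ^ (CARD('d) - 1)"
    by (subst prod.remove[of _ i\<^sub>0]) (simp_all add: card_Diff_singleton)
  finally have "measure lborel ?B = \<rho> * (2 * \<delta>) ^ (CARD('d) - 1)" .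
  moreover have "emeasure lborel ?B = ennreal (measure lborel ?B)"
    by (rule emeasure_eq_ennreal_measure)
      (simp add: emeasure_lborel_cbox_eq)
  ultimately show ?thesis
    by simp
qed

text \<open>By hypothesis the projection of \<open>E\<close> along the direction
  \<open>i\<^sub>0\<close> covers a (d-1)-dimensional face. Rather than measuring in dimension d -
  1, each covering set of diameter \<delta> is replaced by a slab of volume \<rho> (2\<delta>)^(d-1)
  containing every point of the cube that shares its shadow. The slabs cover a cube of volume
  \<rho>^d, so the sum of the \<delta>^(d-1) is at least (\<rho>/2)^(d-1).\<close>

lemma hausdorff_measure_pos_if_shadow:
  fixes E :: "(real ^ 'd) set" and c :: "real ^ 'd"
  assumes "\<rho> > 0" "CARD('d) > 1"
    and shadow: "\<And>u. (\<And>i. c $ i \<le> u $ i \<and> u $ i \<le> c $ i + \<rho>) \<Longrightarrow> \<exists>x\<in>E. \<forall>i. i \<noteq> i\<^sub>0 \<longrightarrow> x $ i = u $ i"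
  shows "hausdorff_measure (real (CARD('d) - 1)) E > 0"
proof -
  let ?s = "CARD('d) - 1"
  define Q where "Q = cbox c (\<chi> i. c $ i + \<rho>)"
  let ?m = "\<chi> i. c $ i + \<rho> / 2"
  have "Q = cbox (\<chi> i. if i = i\<^sub>0 then c $ i else ?m $ i - \<rho> / 2) (\<chi> i. if i = i\<^sub>0 then c $ i + \<rho> else ?m $ i + \<rho> / 2)"
    unfolding Q_def by (rule arg_cong2[where f = cbox]) (auto simp: vec_eq_iff)
  then have Q: "emeasure lborel Q = ennreal (\<rho> * \<rho> ^ ?s)"
    using emeasure_lborel_slab[of "\<rho> / 2" \<rho> i\<^sub>0 c ?m] \<open>\<rho> > 0\<close> by simp
  \<comment> \<open>Positivity at the single scale 1 suffices, the measure being a supremum over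
    scales.\<close>
  have "ennreal (\<rho> * \<rho> ^ ?s) \<le> ennreal (\<rho> * 2 ^ ?s) * hausdorff_premeasure (real ?s) 1 E"
  proof -
    have "ennreal (\<rho> ^ ?s / 2 ^ ?s) \<le> (\<Sum>n. ennreal (diameter (A n) powr real ?s))"
      if bd: "\<And>n. bounded (A n)" and cover: "E \<subseteq> (\<Union>n. A n)" for A :: "nat \<Rightarrow> (real ^ 'd) set"
    proof -
      define y where "y n = (SOME y. y \<in> A n)" for n
      \<comment> \<open>The sets of the cover, thickened in direction \<open>i\<^sub>0\<close>, cover the cube.\<close>
      define B where "B n = (if A n = {} then {} else
        cbox (\<chi> i. if i = i\<^sub>0 then c $ i else y n $ i - diameter (A n))
             (\<chi> i. if i = i\<^sub>0 then c $ i + \<rho> else y n $ i + diameter (A n)))" for n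
      have B: "emeasure lborel (B n) \<le> ennreal (\<rho> * 2 ^ ?s) * ennreal (diameter (A n) powr real ?s)" for n
      proof (cases "A n = {}")
        case False
        have "diameter (A n) \<ge> 0"
          using bd by (rule diameter_ge_0)
        \<comment> \<open>Zero diameter is treated apart: both powers vanish there because d - 1 >
          0.\<close>
        moreover from this have "diameter (A n) ^ ?s = diameter (A n) powr real ?s"
          using \<open>CARD('d) > 1\<close> powr_realpow[of "diameter (A n)" ?s] by (cases "diameter (A n) = 0") auto
        ultimately show ?thesis
          using emeasure_lborel_slab[of "diameter (A n)" \<rho> i\<^sub>0 c "y n"] False \<open>\<rho> > 0\<close>
          by (simp add: B_def power_mult_distrib mult.assoc flip: ennreal_mult)
      qed (simp add: B_def)
      have "Q \<subseteq> (\<Union>n. B n)"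
      proof
        fix u assume u: "u \<in> Q"
        then have uc: "c $ i \<le> u $ i \<and> u $ i \<le> c $ i + \<rho>" for i
          by (auto simp: Q_def mem_box_cart)
        then obtain x where x: "x \<in> E" "\<forall>i. i \<noteq> i\<^sub>0 \<longrightarrow> x $ i = u $ i"
          using shadow by blast
        then obtain n where n: "x \<in> A n"
          using cover by blast
        then have "y n \<in> A n"
          unfolding y_def by (rule someI)
        then have "dist x (y n) \<le> diameter (A n)"
          using diameter_bounded_bound[OF bd[of n] n] by simp
        then have "\<bar>x $ i - y n $ i\<bar> \<le> diameter (A n)" for i
          using dist_vec_nth_le[of x i "y n"] by (simp add: dist_real_def)
        then have "\<bar>u $ i - y n $ i\<bar> \<le> diameter (A n)" if "i \<noteq> i\<^sub>0" for i
          using x(2) that by metis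
        then have "u \<in> B n"
          using n uc by (auto simp: B_def mem_box_cart abs_le_iff algebra_simps)
        then show "u \<in> (\<Union>n. B n)"
          by blast
      qed
      then have "ennreal (\<rho> * \<rho> ^ ?s) \<le> emeasure lborel (\<Union>n. B n)"
        unfolding Q[symmetric] by (intro emeasure_mono) (auto simp: B_def)
      also have "\<dots> \<le> (\<Sum>n. emeasure lborel (B n))"
        by (rule emeasure_subadditive_countably) (auto simp: B_def)
      also have "\<dots> \<le> (\<Sum>n. ennreal (\<rho> * 2 ^ ?s) * ennreal (diameter (A n) powr real ?s))"
        by (intro suminf_le B) auto
      also have "\<dots> = ennreal (\<rho> * 2 ^ ?s) * (\<Sum>n. ennreal (diameter (A n) powr real ?s))"
        by simp
      finally have *: "ennreal (\<rho> * \<rho> ^ ?s) \<le> \<dots>" .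
      have "ennreal (1 / (\<rho> * 2 ^ ?s)) * ennreal (\<rho> * \<rho> ^ ?s) \<le>
          ennreal (1 / (\<rho> * 2 ^ ?s)) * (ennreal (\<rho> * 2 ^ ?s) * (\<Sum>n. ennreal (diameter (A n) powr real ?s)))"
        by (intro mult_left_mono *) simp
      then show ?thesis
        using \<open>\<rho> > 0\<close> by (simp add: mult.assoc[symmetric] ennreal_mult[symmetric])
    qed
    then have "ennreal (\<rho> ^ ?s / 2 ^ ?s) \<le> hausdorff_premeasure (real ?s) 1 E"
      unfolding hausdorff_premeasure_def by (intro INF_greatest) auto
    then have "ennreal (\<rho> * 2 ^ ?s) * ennreal (\<rho> ^ ?s / 2 ^ ?s) \<le> ennreal (\<rho> * 2 ^ ?s) * hausdorff_premeasure (real ?s) 1 E"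
      by (intro mult_left_mono) auto
    then show ?thesis
      using \<open>\<rho> > 0\<close> by (simp add: ennreal_mult[symmetric])
  qed
  moreover have "0 < ennreal (\<rho> * \<rho> ^ ?s)"
    using \<open>\<rho> > 0\<close> by simp
  ultimately have "0 < hausdorff_premeasure (real ?s) 1 E"
    by (metis less_le_not_le mult_zero_right zero_le zero_less_iff_neq_zero)
  also have "\<dots> \<le> hausdorff_measure (real ?s) E"
    unfolding hausdorff_measure_def by (rule SUP_upper) simp
  finally show ?thesis .
qed

section \<open>Locally almost constant perturbations\<close>

lemma locally_compact_sigma_compact:
  fixes \<Omega> :: "'a::euclidean_space set"
  assumes "locally compact \<Omega>"
  obtains K :: "nat \<Rightarrow> 'a set" where "\<And>n. compact (K n)" "\<And>n. K n \<subseteq> \<Omega>" "\<Omega> = (\<Union>n. K n)"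
proof -
  have "\<forall>x\<in>\<Omega>. \<exists>U V. x \<in> U \<and> U \<subseteq> V \<and> V \<subseteq> \<Omega> \<and> openin (top_of_set \<Omega>) U \<and> compact V"
    using assms locally_compact by blast
  then obtain U V where UV: "\<And>x. x \<in> \<Omega> \<Longrightarrow> x \<in> U x \<and> U x \<subseteq> V x \<and> V x \<subseteq> \<Omega> \<and>
      openin (top_of_set \<Omega>) (U x) \<and> compact (V x)"
    by metis
  have "openin (top_of_set \<Omega>) S" if "S \<in> U ` \<Omega>" for S
    using that UV by auto
  then obtain \<F> where F: "\<F> \<subseteq> U ` \<Omega>" "countable \<F>" "\<Union>\<F> = \<Union>(U ` \<Omega>)"
    by (rule Lindelof_openin)
  obtain X where X: "countable X" "X \<subseteq> \<Omega>" "\<F> = U ` X"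
    using F(1,2) by (metis countable_subset_image)
  have cover: "\<Omega> = (\<Union>x\<in>X. V x)"
  proof (intro equalityI subsetI)
    fix x assume "x \<in> \<Omega>"
    then have "x \<in> \<Union>\<F>"
      using UV F(3) by blast
    then obtain y where "y \<in> X" "x \<in> U y"
      unfolding X(3) by blast
    then show "x \<in> (\<Union>x\<in>X. V x)"
      using UV[of y] X(2) by blast
  qed (use UV X(2) in blast)
  \<comment> \<open>The empty set is added so that the family can be enumerated even when \<Omega>
    is empty.\<close>
  let ?\<K> = "insert {} (V ` X)"
  show thesis
  proof (rule that[of "from_nat_into ?\<K>"])
    have mem: "from_nat_into ?\<K> n \<in> ?\<K>" for n
      by (rule from_nat_into) simp
    have "compact L \<and> L \<subseteq> \<Omega>" if "L \<in> ?\<K>" for L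
      using that
    proof
      assume "L \<in> V ` X"
      then obtain x where "x \<in> X" "L = V x"
        by blast
      then show ?thesis
        using UV[of x] X(2) by blast
    qed simp
    then show "compact (from_nat_into ?\<K> n)" "from_nat_into ?\<K> n \<subseteq> \<Omega>" for n
      using mem[of n] by blast+
    have "(\<Union>n. from_nat_into ?\<K> n) = \<Union> ?\<K>"
      using range_from_nat_into[of ?\<K>] X(1) by simp
    then show "\<Omega> = (\<Union>n. from_nat_into ?\<K> n)"
      using cover by simp
  qed
qed

text \<open>One radius serves all centres in \<open>K\<close>. The small balls entering the little
  lip function thus stay in a compact set, where uniform closeness of functions can be
  imposed.\<close>

lemma locally_compact_compact_thickening:
  fixes \<Omega> :: "'a::euclidean_space set"
  assumes "locally compact \<Omega>" "compact K" "K \<subseteq> \<Omega>"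
  obtains r K' where "r > 0" "compact K'" "K' \<subseteq> \<Omega>" "\<And>x. x \<in> K \<Longrightarrow> cball x r \<inter> \<Omega> \<subseteq> K'"
proof -
  obtain U V where UV: "K \<subseteq> U" "U \<subseteq> V" "V \<subseteq> \<Omega>" "openin (top_of_set \<Omega>) U" "compact V"
    using assms unfolding locally_compact_compact by meson
  then obtain T where T: "open T" "U = \<Omega> \<inter> T"
    by (auto simp: openin_open)
  then obtain e where e: "e > 0" "(\<Union>x\<in>K. ball x e) \<subseteq> T"
    using compact_subset_open_imp_ball_epsilon_subset[OF assms(2) T(1)] UV(1) by blast
  have "cball x (e/2) \<inter> \<Omega> \<subseteq> V" if "x \<in> K" for x
  proof -
    have "cball x (e/2) \<subseteq> ball x e"
      using e(1) by auto
    then show ?thesis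
      using that e(2) UV(2) T(2) by blast
  qed
  then show thesis
    using that[of "e/2" V] e(1) UV by simp
qed

section \<open>Cellwise constant approximation and coverings of grid neighbourhoods\<close>

lemma floor_eq_away_from_Ints:
  fixes s t c :: real
  assumes "\<And>k::int. c \<le> \<bar>t - of_int k\<bar>" "\<bar>s - t\<bar> < c"
  shows "\<lfloor>s\<rfloor> = \<lfloor>t\<rfloor>"
proof (rule floor_unique)
  have "c \<le> t - of_int \<lfloor>t\<rfloor>" "c \<le> of_int (\<lfloor>t\<rfloor> + 1) - t"
    using assms(1)[of "\<lfloor>t\<rfloor>"] assms(1)[of "\<lfloor>t\<rfloor> + 1"] by linarith+
  then show "of_int \<lfloor>t\<rfloor> \<le> s" "s < of_int \<lfloor>t\<rfloor> + 1"
    using assms(2) by linarith+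
qed

text \<open>Rounding to the corner of a cell of side 1/N gives a function constant on cells and
  within \<epsilon> of \<open>F\<close>, which may jump across the grid. Away from the grid it is
  continuous, and there its difference from \<open>F\<close> is extended continuously with the same
  bound. The grid is fixed before \<rho>, so the gap around it can be shrunk later without adding
  walls.\<close>

lemma continuous_approx_constant_on_cells:
  fixes f :: "real ^ 'd \<Rightarrow> real"
  assumes "compact K" "continuous_on K f" "\<epsilon> > 0" "K \<subseteq> cball 0 R"
  obtains N :: nat where "N > 0"
    "\<And>\<rho>. \<rho> > 0 \<Longrightarrow> \<exists>g. continuous_on UNIV g \<and> (\<forall>x\<in>K. \<bar>g x - f x\<bar> \<le> \<epsilon>) \<and>
      (\<forall>x\<in>cball 0 R. \<forall>y\<in>cball 0 R. (\<forall>i. \<forall>k::int. \<rho> \<le> \<bar>x $ i - k / N\<bar> \<and> \<rho> \<le> \<bar>y $ i - k / N\<bar>) \<longrightarrow>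
         (\<forall>i. \<lfloor>N * x $ i\<rfloor> = \<lfloor>N * y $ i\<rfloor>) \<longrightarrow> g x = g y)"
proof -
  obtain F where F: "continuous_on UNIV F" "\<And>x. x \<in> K \<Longrightarrow> F x = f x"
    using Tietze_unbounded[of K f UNIV] assms(1,2) compact_imp_closed by auto
  let ?D = "real CARD('d)"
  \<comment> \<open>The ball is enlarged by the number d of coordinates, because rounding moves a
    point by at most d/N \<le> d.\<close>
  have "uniformly_continuous_on (cball 0 (R + ?D)) F"
    by (rule compact_uniformly_continuous) (use F(1) continuous_on_subset in auto)
  then obtain e where e: "e > 0"
    "\<And>x y. x \<in> cball 0 (R + ?D) \<Longrightarrow> y \<in> cball 0 (R + ?D) \<Longrightarrow> dist y x < e \<Longrightarrow> dist (F y) (F x) < \<epsilon>"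
    unfolding uniformly_continuous_on_def using \<open>\<epsilon> > 0\<close> by meson
  obtain N :: nat where N: "?D / e < N"
    using reals_Archimedean2 by blast
  have "?D / e > 0"
    using e(1) by simp
  then have "N > 0"
    using N by (metis less_trans of_nat_0_less_iff)
  have DN: "?D / N < e" "?D / N \<le> ?D"
    using N e(1) \<open>N > 0\<close> by (simp_all add: field_simps)
  define T :: "real ^ 'd \<Rightarrow> real ^ 'd" where "T x = (\<chi> i. \<lfloor>N * x $ i\<rfloor> / N)" for x
  have T: "dist (T x) x \<le> ?D / N" for x
  proof -
    have "dist (T x) x \<le> (\<Sum>i\<in>UNIV. \<bar>(T x - x) $ i\<bar>)"
      unfolding dist_norm by (rule norm_le_l1_cart)
    also have "\<dots> \<le> (\<Sum>i\<in>(UNIV::'d set). 1 / N)"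
    proof (rule sum_mono)
      fix i
      have "\<bar>of_int \<lfloor>N * x $ i\<rfloor> - N * x $ i\<bar> \<le> 1"
        by linarith
      then have "\<bar>of_int \<lfloor>N * x $ i\<rfloor> - N * x $ i\<bar> / N \<le> 1 / N"
        by (simp add: divide_right_mono)
      moreover have "(T x - x) $ i = (of_int \<lfloor>N * x $ i\<rfloor> - N * x $ i) / N"
        using \<open>N > 0\<close> by (simp add: T_def field_simps)
      ultimately show "\<bar>(T x - x) $ i\<bar> \<le> 1 / N"
        by (simp add: abs_divide)
    qed
    finally show ?thesis
      by simp
  qed
  have FT: "\<bar>F (T x) - F x\<bar> \<le> \<epsilon>" if "x \<in> cball 0 R" for x
  proof -
    have "norm (T x) \<le> norm x + dist (T x) x"
      by (metis add.commute diff_add_cancel dist_norm norm_triangle_ineq)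
    then have "T x \<in> cball 0 (R + ?D)"
      using T[of x] DN(2) that by simp
    moreover have "x \<in> cball 0 (R + ?D)"
      using that by simp
    ultimately have "dist (F (T x)) (F x) < \<epsilon>"
      using e(2) T[of x] DN(1) by force
    then show ?thesis
      by (simp add: dist_real_def)
  qed
  show thesis
  proof (rule that[OF \<open>N > 0\<close>])
    fix \<rho> :: real assume "\<rho> > 0"
    \<comment> \<open>The inequality is non-strict to make \<open>S\<close> closed, as the Tietze
      extension requires.\<close>
    define S where "S = cball 0 R \<inter> (\<Inter>i. \<Inter>k::int. {x :: real ^ 'd. \<rho> \<le> \<bar>x $ i - k / N\<bar>})"
    have "closed S"
      unfolding S_def
      by (intro closed_Int closed_INT ballI closed_Collect_le continuous_intros closed_cball)
    have Teq: "T y = T x" if "x \<in> S" "dist y x < \<rho>" for x y :: "real ^ 'd"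
    proof -
      have "\<lfloor>N * y $ i\<rfloor> = \<lfloor>N * x $ i\<rfloor>" for i
      proof (rule floor_eq_away_from_Ints[of "N * \<rho>"])
        fix k :: int
        have "\<rho> \<le> \<bar>x $ i - k / N\<bar>"
          using that(1) by (simp add: S_def)
        then have "N * \<rho> \<le> N * \<bar>x $ i - k / N\<bar>"
          by (simp add: mult_left_mono)
        also have "\<dots> = \<bar>N * x $ i - k\<bar>"
          using \<open>N > 0\<close> by (simp add: abs_if field_simps)
        finally show "N * \<rho> \<le> \<bar>N * x $ i - k\<bar>" .
        have "\<bar>y $ i - x $ i\<bar> < \<rho>"
          using dist_vec_nth_le[of y i x] that(2) by (simp add: dist_real_def)
        then have "N * \<bar>y $ i - x $ i\<bar> < N * \<rho>"
          using \<open>N > 0\<close> by simp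
        then show "\<bar>N * y $ i - N * x $ i\<bar> < N * \<rho>"
          by (simp add: abs_mult flip: right_diff_distrib)
      qed
      then show ?thesis
        by (simp add: T_def)
    qed
    \<comment> \<open>On \<open>S\<close> the rounding is locally constant: by \<open>Teq\<close> it
      does not change within distance \<rho>.\<close>
    have "continuous_on S (\<lambda>x. F (T x))"
      unfolding continuous_on_iff
      using Teq \<open>\<rho> > 0\<close> by (metis dist_self)
    then have "continuous_on S (\<lambda>x. F (T x) - F x)"
      using F(1) by (intro continuous_intros) (auto intro: continuous_on_subset)
    \<comment> \<open>Extending the error, rather than the rounded function itself, keeps the bound
      \<epsilon> everywhere.\<close>
    then obtain D where D: "continuous_on UNIV D" "\<And>x. x \<in> S \<Longrightarrow> D x = F (T x) - F x"
      "\<And>x. norm (D x) \<le> \<epsilon>"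
      using Tietze[of S "\<lambda>x. F (T x) - F x" UNIV \<epsilon>] \<open>closed S\<close> \<open>\<epsilon> > 0\<close> FT
      by (auto simp: S_def)
    show "\<exists>g. continuous_on UNIV g \<and> (\<forall>x\<in>K. \<bar>g x - f x\<bar> \<le> \<epsilon>) \<and>
      (\<forall>x\<in>cball 0 R. \<forall>y\<in>cball 0 R. (\<forall>i. \<forall>k::int. \<rho> \<le> \<bar>x $ i - k / N\<bar> \<and> \<rho> \<le> \<bar>y $ i - k / N\<bar>) \<longrightarrow>
         (\<forall>i. \<lfloor>N * x $ i\<rfloor> = \<lfloor>N * y $ i\<rfloor>) \<longrightarrow> g x = g y)"
    proof (intro exI[of _ "\<lambda>x. F x + D x"] conjI ballI impI)
      show "continuous_on UNIV (\<lambda>x. F x + D x)"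
        using F(1) D(1) by (intro continuous_intros)
      show "\<bar>F x + D x - f x\<bar> \<le> \<epsilon>" if "x \<in> K" for x
        using F(2)[OF that] D(3)[of x] by simp
      fix x y :: "real ^ 'd"
      assume "x \<in> cball 0 R" "y \<in> cball 0 R"
        and "\<forall>i. \<forall>k::int. \<rho> \<le> \<bar>x $ i - k / N\<bar> \<and> \<rho> \<le> \<bar>y $ i - k / N\<bar>"
        and fl: "\<forall>i. \<lfloor>N * x $ i\<rfloor> = \<lfloor>N * y $ i\<rfloor>"
      then have "x \<in> S" "y \<in> S"
        unfolding S_def by blast+
      moreover have "T x = T y"
        using fl by (simp add: T_def)
      ultimately show "F x + D x = F y + D y"
        using D(2) by simp
    qed
  qed
qed

text \<open>A strip of width 1/q around one wall is cut by a grid of mesh 1/q in the other d - 1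
  directions into cubes of diameter at most d/q. The three factors count the directions, the walls
  that can come near the box, and the cubes per wall; only the last grows with q, like
  q^(d-1).\<close>

lemma covering_number_grid_nbhd:
  fixes N q m :: nat
  assumes "N > 0" "q > 0"
  shows "covering_number (real CARD('d) / q)
      {x :: real ^ 'd. (\<forall>i. \<bar>x $ i\<bar> \<le> m) \<and> (\<exists>i. \<exists>k::int. \<bar>x $ i - k / N\<bar> \<le> 1 / (2 * q))}
    \<le> enat (CARD('d) * ((2 * (N * (m + 1)) + 1) * (2 * (q * m) + 1) ^ (CARD('d) - 1)))"
    (is "covering_number ?\<delta> ?E \<le> enat ?n")
proof -
  define cell :: "'d \<Rightarrow> int \<Rightarrow> ('d \<Rightarrow> int) \<Rightarrow> (real ^ 'd) set" where
    "cell i k j = {x. \<bar>x $ i - k / N\<bar> \<le> 1 / (2 * q) \<and> (\<forall>l. l \<noteq> i \<longrightarrow> j l \<le> q * x $ l \<and> q * x $ l \<le> j l + 1)}"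
    for i k j
  \<comment> \<open>A wall near the box satisfies |k/N| \<le> m + 1/(2q) \<le> m + 1.\<close>
  let ?I = "{- int (N * (m + 1))..int (N * (m + 1))}"
  \<comment> \<open>\<open>cell i k j\<close> does not look at \<open>j i\<close>; fixing this value
    through \<open>PiE\<close> leaves d - 1 free indices to count.\<close>
  let ?J = "\<lambda>i. PiE (UNIV - {i}) (\<lambda>_. {- int (q * m)..int (q * m)})"
  let ?\<U> = "\<Union>i. \<Union>k\<in>?I. cell i k ` ?J i"
  have fin: "finite (?J i)" for i :: 'd
    by (intro finite_PiE) auto
  have "card ?\<U> \<le> (\<Sum>i\<in>(UNIV :: 'd set). card (\<Union>k\<in>?I. cell i k ` ?J i))"
    by (rule card_UN_le) simp
  also have "\<dots> \<le> (\<Sum>i\<in>(UNIV :: 'd set). \<Sum>k\<in>?I. card (cell i k ` ?J i))"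
    by (intro sum_mono card_UN_le) simp
  also have "\<dots> \<le> (\<Sum>i\<in>(UNIV :: 'd set). \<Sum>k\<in>?I. card (?J i))"
    using fin by (intro sum_mono card_image_le)
  also have "\<dots> = ?n"
    by (simp add: card_PiE nat_add_distrib nat_mult_distrib card_Diff_singleton algebra_simps)
  finally have card: "card ?\<U> \<le> ?n" .
  have diam: "norm (x - y) \<le> ?\<delta>" if "x \<in> cell i k j" "y \<in> cell i k j" for x y and i :: 'd and k j
  proof -
    have "norm (x - y) \<le> (\<Sum>l\<in>UNIV. \<bar>(x - y) $ l\<bar>)"
      by (rule norm_le_l1_cart)
    also have "\<dots> \<le> (\<Sum>l\<in>(UNIV::'d set). 1 / q)"
    proof (rule sum_mono)
      fix l
      show "\<bar>(x - y) $ l\<bar> \<le> 1 / q"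
      proof (cases "l = i")
        case True
        have "\<bar>x $ i - k / N\<bar> \<le> 1 / (2 * q)" "\<bar>y $ i - k / N\<bar> \<le> 1 / (2 * q)"
          using that by (auto simp: cell_def)
        moreover have "1 / (2 * q) + 1 / (2 * q) = 1 / real q"
          by simp
        ultimately show ?thesis
          unfolding True vector_minus_component by linarith
      next
        case False
        then have "j l \<le> q * x $ l" "q * x $ l \<le> j l + 1" "j l \<le> q * y $ l" "q * y $ l \<le> j l + 1"
          using that by (auto simp: cell_def)
        then have "\<bar>q * x $ l - q * y $ l\<bar> \<le> 1"
          by linarith
        then have "q * \<bar>x $ l - y $ l\<bar> \<le> 1"
          by (simp add: abs_mult flip: right_diff_distrib)
        then show ?thesis
          using \<open>q > 0\<close> by (simp add: field_simps)
      qed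
    qed
    finally show ?thesis
      by simp
  qed
  have "covering_number ?\<delta> ?E \<le> enat (card ?\<U>)"
  proof (rule covering_number_le_card)
    show "finite ?\<U>"
      using fin by auto
    fix U assume "U \<in> ?\<U>"
    then obtain i k j where U: "U = cell i k j"
      by blast
    show "bounded U \<and> diameter U \<le> ?\<delta>"
      unfolding U bounded_two_points dist_norm
      using diam diameter_le[of "cell i k j" ?\<delta>] by (metis divide_nonneg_nonneg of_nat_0_le_iff)
  next
    show "?E \<subseteq> \<Union>?\<U>"
    proof safe
      fix x :: "real ^ 'd" and i and k :: int
      assume m: "\<forall>i. \<bar>x $ i\<bar> \<le> m" and k: "\<bar>x $ i - k / N\<bar> \<le> 1 / (2 * q)"
      have "1 / (2 * q) \<le> (1::real)"
        using \<open>q > 0\<close> by (simp add: field_simps)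
      then have "\<bar>k / N\<bar> \<le> m + 1"
        using k spec[OF m, of i] by linarith
      then have "\<bar>k\<bar> \<le> real (N * (m + 1))"
        using \<open>N > 0\<close> by (simp add: field_simps)
      then have "k \<in> ?I"
        by (simp only: atLeastAtMost_iff) linarith
      define j where "j = restrict (\<lambda>l. \<lfloor>q * x $ l\<rfloor>) (UNIV - {i})"
      have "\<lfloor>q * x $ l\<rfloor> \<in> {- int (q * m)..int (q * m)}" for l
      proof -
        have "q * \<bar>x $ l\<bar> \<le> q * m"
          using m by (simp add: mult_left_mono)
        then have "\<bar>q * x $ l\<bar> \<le> q * m"
          by (simp add: abs_mult)
        then have "- real (q * m) \<le> q * x $ l" "q * x $ l \<le> real (q * m)"
          by (simp_all only: abs_le_iff) linarith+
        then show ?thesis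
          by (simp only: atLeastAtMost_iff) linarith
      qed
      then have "j \<in> ?J i"
        by (auto simp: j_def)
      moreover have "x \<in> cell i k j"
        unfolding cell_def j_def using k by auto
      ultimately show "x \<in> \<Union>?\<U>"
        using \<open>k \<in> ?I\<close> by blast
    qed
  qed
  also have "\<dots> \<le> enat ?n"
    using card by simp
  finally show ?thesis .
qed

text \<open>With \<open>c\<close> collecting the factors independent of q, a count of order q^(d-1)
  meets (d/q)^(d-1+\<tau>), so the product is bounded by a multiple of q^(-\<tau>).\<close>

lemma eventually_scaled_covering_bound:
  fixes \<tau> c :: real
  assumes "\<tau> > 0" "d > 0"
  shows "\<forall>\<^sub>F q in sequentially. c * (real (2 * (q * m) + 1) ^ (d - 1)) * (real d / real q) powr (real (d - 1) + \<tau>) \<le> \<tau>"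
proof -
  define B where "B = \<bar>c\<bar> * real (2 * m + 1) ^ (d - 1) * real d powr (real (d - 1) + \<tau>)"
  have "(\<lambda>q. B * real q powr (- \<tau>)) \<longlonglongrightarrow> B * 0"
    using \<open>\<tau> > 0\<close>
    by (intro tendsto_mult tendsto_const tendsto_neg_powr filterlim_real_sequentially) auto
  then have "\<forall>\<^sub>F q in sequentially. B * real q powr (- \<tau>) < \<tau>"
    using \<open>\<tau> > 0\<close> by (intro order_tendstoD) auto
  with eventually_gt_at_top[of 0] show ?thesis
  proof eventually_elim
    case (elim q)
    have "real (2 * (q * m) + 1) ^ (d - 1) \<le> (real (2 * m + 1) * real q) ^ (d - 1)"
    proof (rule power_mono)
      have "1 \<le> real q"
        using elim by simp
      then show "real (2 * (q * m) + 1) \<le> real (2 * m + 1) * real q"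
        by (simp add: algebra_simps)
    qed simp
    then have "c * (real (2 * (q * m) + 1) ^ (d - 1)) \<le> \<bar>c\<bar> * (real (2 * m + 1) * real q) ^ (d - 1)"
      by (intro mult_mono) auto
    then have "c * (real (2 * (q * m) + 1) ^ (d - 1)) * (real d / real q) powr (real (d - 1) + \<tau>)
      \<le> \<bar>c\<bar> * (real (2 * m + 1) * real q) ^ (d - 1) * (real d / real q) powr (real (d - 1) + \<tau>)"
      by (rule mult_right_mono) simp
    also have "\<dots> = B * (real q ^ (d - 1) * (1 / real q powr (real (d - 1) + \<tau>)))"
      unfolding B_def using elim by (simp add: power_mult_distrib powr_divide)
    also have "real q ^ (d - 1) * (1 / real q powr (real (d - 1) + \<tau>)) = real q powr (- \<tau>)"
      using elim by (simp add: powr_add powr_realpow powr_minus_divide)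
    finally show ?case
      using elim by simp
  qed
qed

lemma ennreal_of_enat_le_mult:
  assumes "k \<le> enat n" "real n * r \<le> t" "r \<ge> 0"
  shows "ennreal_of_enat k * ennreal r \<le> ennreal t"
proof -
  have "ennreal_of_enat k \<le> ennreal_of_enat (enat n)"
    using assms(1) by (simp only: ennreal_of_enat_le_iff)
  then have "ennreal_of_enat k * ennreal r \<le> ennreal (real n) * ennreal r"
    by (intro mult_right_mono) (simp_all add: ennreal_of_nat_eq_real_of_nat)
  also have "\<dots> \<le> ennreal t"
    using assms(2,3) by (simp add: ennreal_mult[symmetric] ennreal_leI)
  finally show ?thesis .
qed

lemma diameter_image_le:
  fixes h :: "'a \<Rightarrow> real"
  assumes "c \<ge> 0" "\<And>x y. x \<in> S \<Longrightarrow> y \<in> S \<Longrightarrow> \<bar>h x - h y\<bar> \<le> c"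
  shows "diameter (h ` S) \<le> c"
  by (rule diameter_le) (use assms in auto)

text \<open>The density step of the upper bound. The grid is fixed first, then q is taken so large
  that covering the grid neighbourhood is cheap, and \<open>g\<close> is built with gap r = 1/(4q).
  A centre farther than 2r from all walls has its whole ball inside one cell and at least r from the
  walls, where \<open>g\<close> is constant; so functions close to \<open>g\<close> oscillate little
  on that ball.\<close>

lemma exists_stable_small_oscillation:
  fixes \<Omega> :: "(real ^ 'd) set" and \<phi> :: "real \<Rightarrow> real" and f :: "real ^ 'd \<Rightarrow> real" and \<epsilon> \<tau> :: real
  assumes \<phi>: "\<And>r. r > 0 \<Longrightarrow> \<phi> r > 0" and \<Omega>: "locally compact \<Omega>"
    and C: "compact C" "C \<subseteq> \<Omega>" and f: "continuous_on \<Omega> f"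
    and K: "compact K" "K \<subseteq> \<Omega>" and "\<epsilon> > 0" "\<tau> > 0"
  shows "\<exists>g K' \<eta>. continuous_on \<Omega> g \<and> (\<forall>x\<in>K. \<bar>g x - f x\<bar> < \<epsilon>) \<and> compact K' \<and> K' \<subseteq> \<Omega> \<and> \<eta> > 0 \<and>
    (\<forall>h. continuous_on \<Omega> h \<longrightarrow> (\<forall>x\<in>K'. \<bar>h x - g x\<bar> < \<eta>) \<longrightarrow>
      (\<exists>r \<delta>. 0 < r \<and> r < \<tau> \<and> 0 < \<delta> \<and> \<delta> < \<tau> \<and>
        ennreal_of_enat (covering_number \<delta> {x \<in> C. \<tau> * \<phi> r < diameter (h ` (cball x r \<inter> \<Omega>))})
          * ennreal (\<delta> powr (real (CARD('d) - 1) + \<tau>)) \<le> ennreal \<tau>))"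
proof -
  obtain r\<^sub>0 C' where C': "r\<^sub>0 > 0" "compact C'" "C' \<subseteq> \<Omega>" "\<And>x. x \<in> C \<Longrightarrow> cball x r\<^sub>0 \<inter> \<Omega> \<subseteq> C'"
    using locally_compact_compact_thickening[OF \<Omega> C] by blast
  \<comment> \<open>\<open>C'\<close> holds the balls on which oscillation is measured,
    \<open>K\<close> the points where \<open>g\<close> must approximate \<open>f\<close>.\<close>
  let ?K' = "K \<union> C'"
  have K': "compact ?K'" "?K' \<subseteq> \<Omega>"
    using K C' by auto
  obtain R where R: "?K' \<subseteq> cball 0 R"
    using compact_imp_bounded[OF K'(1)] by (auto simp: bounded_iff subset_iff)
  have "\<epsilon> / 2 > 0"
    using \<open>\<epsilon> > 0\<close> by simp
  then obtain N :: nat where N: "N > 0"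
    "\<And>\<rho>. \<rho> > 0 \<Longrightarrow> \<exists>g. continuous_on UNIV g \<and> (\<forall>x\<in>?K'. \<bar>g x - f x\<bar> \<le> \<epsilon> / 2) \<and>
      (\<forall>x\<in>cball 0 R. \<forall>y\<in>cball 0 R. (\<forall>i. \<forall>k::int. \<rho> \<le> \<bar>x $ i - k / N\<bar> \<and> \<rho> \<le> \<bar>y $ i - k / N\<bar>) \<longrightarrow>
         (\<forall>i. \<lfloor>N * x $ i\<rfloor> = \<lfloor>N * y $ i\<rfloor>) \<longrightarrow> g x = g y)"
    using continuous_approx_constant_on_cells[OF K'(1) continuous_on_subset[OF f K'(2)] _ R, of "\<epsilon> / 2"]
    by metis
  let ?d = "CARD('d)"
  obtain m :: nat where m: "R \<le> m"
    using real_arch_simple by blast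
  define c where "c = real (?d * (2 * (N * (m + 1)) + 1))"
  have "\<forall>\<^sub>F q in sequentially. 1 / real (4 * q) < \<tau>" "\<forall>\<^sub>F q in sequentially. 1 / real (4 * q) < r\<^sub>0"
    "\<forall>\<^sub>F q in sequentially. real ?d / real q < \<tau>"
  proof -
    have l: "(\<lambda>q. a / real q) \<longlonglongrightarrow> 0" for a :: real
      by (rule lim_const_over_n)
    show "\<forall>\<^sub>F q in sequentially. real ?d / real q < \<tau>"
      by (rule order_tendstoD(2)[OF l \<open>\<tau> > 0\<close>])
    show "\<forall>\<^sub>F q in sequentially. 1 / real (4 * q) < \<tau>" "\<forall>\<^sub>F q in sequentially. 1 / real (4 * q) < r\<^sub>0"
      using order_tendstoD(2)[OF l \<open>\<tau> > 0\<close>, of "1/4"] order_tendstoD(2)[OF l \<open>r\<^sub>0 > 0\<close>, of "1/4"]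
      by simp_all
  qed
  then have "\<forall>\<^sub>F q in sequentially. q > 0 \<and> 1 / real (4 * q) < \<tau> \<and> 1 / real (4 * q) < r\<^sub>0 \<and> real ?d / real q < \<tau> \<and>
      c * (real (2 * (q * m) + 1) ^ (?d - 1)) * (real ?d / real q) powr (real (?d - 1) + \<tau>) \<le> \<tau>"
    using eventually_gt_at_top[of 0] eventually_scaled_covering_bound[OF \<open>\<tau> > 0\<close>, of ?d c m]
    by (auto intro!: eventually_conj)
  then obtain q where q: "q > 0" "1 / real (4 * q) < \<tau>" "1 / real (4 * q) < r\<^sub>0" "real ?d / real q < \<tau>"
    "c * (real (2 * (q * m) + 1) ^ (?d - 1)) * (real ?d / real q) powr (real (?d - 1) + \<tau>) \<le> \<tau>"
    by (auto dest: eventually_happens)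
  \<comment> \<open>The neighbourhood covered by cubes has half-width 1/(2q) = 2r: one r for the
    ball and one for the gap in \<open>g\<close>.\<close>
  define r where "r = 1 / real (4 * q)"
  have r: "r > 0" "r < \<tau>" "r < r\<^sub>0" "2 * r = 1 / (2 * real q)"
    using q by (auto simp: r_def)
  obtain g where g: "continuous_on UNIV g" "\<And>x. x \<in> ?K' \<Longrightarrow> \<bar>g x - f x\<bar> \<le> \<epsilon> / 2"
    "\<And>x y. x \<in> cball 0 R \<Longrightarrow> y \<in> cball 0 R \<Longrightarrow>
      (\<And>i (k::int). r \<le> \<bar>x $ i - k / N\<bar> \<and> r \<le> \<bar>y $ i - k / N\<bar>) \<Longrightarrow>
      (\<And>i. \<lfloor>N * x $ i\<rfloor> = \<lfloor>N * y $ i\<rfloor>) \<Longrightarrow> g x = g y"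
    using N(2)[OF r(1)] by metis
  \<comment> \<open>Two values of \<open>h\<close>, each within \<eta> of the same value of
    \<open>g\<close>, differ by at most \<open>\<tau> * \<phi> r\<close>.\<close>
  define \<eta> where "\<eta> = \<tau> * \<phi> r / 2"
  have "\<eta> > 0"
    using \<phi>[OF r(1)] \<open>\<tau> > 0\<close> by (simp add: \<eta>_def)
  define G where "G = {x :: real ^ 'd. (\<forall>i. \<bar>x $ i\<bar> \<le> m) \<and> (\<exists>i. \<exists>k::int. \<bar>x $ i - k / N\<bar> \<le> 1 / (2 * q))}"
  have osc: "diameter (h ` (cball x r \<inter> \<Omega>)) \<le> \<tau> * \<phi> r"
    if h: "\<forall>x\<in>?K'. \<bar>h x - g x\<bar> < \<eta>" and x: "x \<in> C" "x \<notin> G" for h x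
  proof -
    have sub: "cball x r \<inter> \<Omega> \<subseteq> ?K'"
    proof -
      have "cball x r \<subseteq> cball x r\<^sub>0"
        using r(3) by auto
      then show ?thesis
        using C'(4)[OF x(1)] by blast
    qed
    then have xR: "x \<in> cball 0 R"
      using r(1) x(1) C(2) R by force
    have "\<bar>x $ i\<bar> \<le> m" for i
      using component_le_norm_cart[of x i] xR m by simp
    have off: "2 * r < \<bar>x $ i - k / N\<bar>" for i and k :: int
    proof -
      have "\<not> \<bar>x $ i - k / N\<bar> \<le> 1 / real (2 * q)"
        using \<open>\<And>i. \<bar>x $ i\<bar> \<le> m\<close> x(2) unfolding G_def by blast
      then show ?thesis
        unfolding r(4) by simp
    qed
    have const: "g y = g x" if y: "y \<in> cball x r \<inter> \<Omega>" for y
    proof (rule g(3))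
      show "y \<in> cball 0 R"
        using y sub R by blast
      show "x \<in> cball 0 R"
        by (rule xR)
      have yx: "\<bar>y $ i - x $ i\<bar> \<le> r" for i
        using dist_vec_nth_le[of x i y] y by (simp add: dist_real_def abs_minus_commute)
      show "r \<le> \<bar>y $ i - k / N\<bar> \<and> r \<le> \<bar>x $ i - k / N\<bar>" for i and k :: int
        using yx[of i] off[of i k] r(1) by linarith
      show "\<lfloor>N * y $ i\<rfloor> = \<lfloor>N * x $ i\<rfloor>" for i
      proof (rule floor_eq_away_from_Ints[of "N * (2 * r)"])
        fix k :: int
        have "N * (2 * r) \<le> N * \<bar>x $ i - k / N\<bar>"
          using off[of i k] by (intro mult_left_mono) auto
        also have "\<dots> = \<bar>N * x $ i - k\<bar>"
          using N(1) by (simp add: abs_if field_simps)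
        finally show "N * (2 * r) \<le> \<bar>N * x $ i - k\<bar>" .
        have "N * \<bar>y $ i - x $ i\<bar> < N * (2 * r)"
          using N(1) yx[of i] r(1) by (intro mult_strict_left_mono) auto
        then show "\<bar>N * y $ i - N * x $ i\<bar> < N * (2 * r)"
          by (simp add: abs_mult flip: right_diff_distrib)
      qed
    qed
    show ?thesis
    proof (rule diameter_image_le)
      fix y z assume yz: "y \<in> cball x r \<inter> \<Omega>" "z \<in> cball x r \<inter> \<Omega>"
      then have "\<bar>h y - g y\<bar> < \<eta>" "\<bar>h z - g z\<bar> < \<eta>"
        using h sub by auto
      then show "\<bar>h y - h z\<bar> \<le> \<tau> * \<phi> r"
        using const[OF yz(1)] const[OF yz(2)] unfolding \<eta>_def by linarith
    qed (use \<phi>[OF r(1)] \<open>\<tau> > 0\<close> in simp)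
  qed
  have small: "\<exists>r \<delta>. 0 < r \<and> r < \<tau> \<and> 0 < \<delta> \<and> \<delta> < \<tau> \<and>
        ennreal_of_enat (covering_number \<delta> {x \<in> C. \<tau> * \<phi> r < diameter (h ` (cball x r \<inter> \<Omega>))})
          * ennreal (\<delta> powr (real (?d - 1) + \<tau>)) \<le> ennreal \<tau>"
    if h: "\<forall>x\<in>?K'. \<bar>h x - g x\<bar> < \<eta>" for h
  proof -
    let ?B = "{x \<in> C. \<tau> * \<phi> r < diameter (h ` (cball x r \<inter> \<Omega>))}"
    have "?B \<subseteq> G"
      using osc[OF h] by force
    then have "covering_number (?d / q) ?B \<le> covering_number (?d / q) G"
      by (rule covering_number_mono)
    also have "\<dots> \<le> enat (?d * ((2 * (N * (m + 1)) + 1) * (2 * (q * m) + 1) ^ (?d - 1)))"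
      unfolding G_def by (rule covering_number_grid_nbhd[OF N(1) q(1)])
    finally have "ennreal_of_enat (covering_number (?d / q) ?B) *
        ennreal ((?d / q) powr (real (?d - 1) + \<tau>)) \<le> ennreal \<tau>"
      by (rule ennreal_of_enat_le_mult)
        (use q(5) in \<open>simp_all only: c_def of_nat_mult of_nat_power mult.assoc powr_ge_zero\<close>)
    then show ?thesis
      using q r by (intro exI[of _ r] exI[of _ "?d / q"]) simp
  qed
  show ?thesis
  proof (rule exI[of _ g], rule exI[of _ ?K'], rule exI[of _ \<eta>], intro conjI allI impI)
    show "continuous_on \<Omega> g"
      using g(1) continuous_on_subset by blast
    show "\<forall>x\<in>K. \<bar>g x - f x\<bar> < \<epsilon>"
      using g(2) \<open>\<epsilon> > 0\<close> by fastforce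
  qed (use K' \<open>\<eta> > 0\<close> small in simp_all)
qed

section \<open>From cheap coverings to the upper bound on the lower packing dimension\<close>

lemma lower_box_premeasure_eq_0I:
  assumes "\<And>e. e > 0 \<Longrightarrow> \<exists>\<delta>. 0 < \<delta> \<and> \<delta> < e \<and>
    ennreal_of_enat (covering_number \<delta> A) * ennreal (\<delta> powr s) \<le> ennreal e"
  shows "lower_box_premeasure s A = 0"
proof (rule ccontr)
  assume "lower_box_premeasure s A \<noteq> 0"
  then have "0 < lower_box_premeasure s A"
    by (simp add: zero_less_iff_neq_zero)
  then obtain c where c: "0 < c" "c < lower_box_premeasure s A"
    using dense by blast
  then have "c < top"
    using less_top by fastforce
  then obtain c' where c': "c = ennreal c'" "c' > 0"
    using c(1) by (cases c) auto
  have "\<forall>\<^sub>F \<delta> in at_right 0. c < ennreal_of_enat (covering_number \<delta> A) * ennreal (\<delta> powr s)"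
    using c(2) unfolding lower_box_premeasure_def by (rule less_LiminfD)
  then obtain b where b: "b > 0"
    "\<And>\<delta>. 0 < \<delta> \<Longrightarrow> \<delta> < b \<Longrightarrow> c < ennreal_of_enat (covering_number \<delta> A) * ennreal (\<delta> powr s)"
    by (auto simp: eventually_at_right_field)
  \<comment> \<open>\<open>min b c'\<close> bounds the scale and the value at once: below
    \<open>b\<close> the eventual lower bound \<open>c\<close> applies, and the value is at most
    \<open>c\<close>.\<close>
  obtain \<delta> where \<delta>: "0 < \<delta>" "\<delta> < min b c'"
    "ennreal_of_enat (covering_number \<delta> A) * ennreal (\<delta> powr s) \<le> ennreal (min b c')"
    using assms[of "min b c'"] b(1) c'(2) by auto
  have "c < ennreal (min b c')"
    using b(2)[of \<delta>] \<delta> by (auto intro: less_le_trans)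
  moreover have "ennreal (min b c') \<le> c"
    unfolding c'(1) by (intro ennreal_leI) simp
  ultimately show False
    by simp
qed

lemma lower_packing_measure_eq_0I:
  assumes "countable \<A>" "\<A> \<noteq> {}" "E \<subseteq> \<Union>\<A>" "\<And>A. A \<in> \<A> \<Longrightarrow> lower_box_premeasure s A = 0"
  shows "lower_packing_measure s E = 0"
proof -
  have zero: "lower_box_premeasure s (from_nat_into \<A> n) = 0" for n
    by (rule assms(4)[OF from_nat_into[OF assms(2)]])
  have "lower_packing_measure s E \<le> (\<Sum>n. lower_box_premeasure s (from_nat_into \<A> n))"
    unfolding lower_packing_measure_def
    by (rule INF_lower) (use assms(1-3) range_from_nat_into in auto)
  then show ?thesis
    by (simp add: zero)
qed

text \<open>Here \<open>Q n r x\<close> stands for a large oscillation at \<open>x\<close> on scale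
  \<open>r\<close>. One scale \<open>r j n\<close> is fixed for every piece and level. A point of
  \<open>E\<close> is bad at all of them from some level m on, hence lies in some
  \<open>A j m\<close>, and each such set inherits cheap coverings at arbitrarily small scales,
  which is enough for a lower limit.\<close>

lemma lower_packing_dim_small_oscillation:
  fixes K :: "nat \<Rightarrow> 'a::metric_space set"
  assumes E: "E \<subseteq> (\<Union>j. K j)"
    and small: "\<And>j n. \<exists>r \<delta>. 0 < r \<and> r < 1 / Suc n \<and> 0 < \<delta> \<and> \<delta> < 1 / Suc n \<and>
        ennreal_of_enat (covering_number \<delta> {x \<in> K j. Q n r x}) * ennreal (\<delta> powr (d + 1 / Suc n))
          \<le> ennreal (1 / Suc n)"
    and lim: "\<And>x. x \<in> E \<Longrightarrow> \<exists>m. \<forall>n\<ge>m. \<forall>r. 0 < r \<longrightarrow> r < 1 / Suc n \<longrightarrow> Q n r x"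
  shows "lower_packing_dim E \<le> of_nat d"
proof (rule lower_packing_dim_le)
  fix s :: real assume s: "s > d"
  define T where "T j n r \<delta> \<longleftrightarrow> 0 < r \<and> r < 1 / Suc n \<and> 0 < \<delta> \<and> \<delta> < 1 / Suc n \<and>
    ennreal_of_enat (covering_number \<delta> {x \<in> K j. Q n r x}) * ennreal (\<delta> powr (d + 1 / Suc n))
      \<le> ennreal (1 / Suc n)" for j n r \<delta>
  have "\<exists>r \<delta>. T j n r \<delta>" for j n
    unfolding T_def by (rule small)
  then obtain r \<delta> where "\<And>j n. T j n (r j n) (\<delta> j n)"
    by metis
  then have r: "\<And>j n. 0 < r j n" "\<And>j n. r j n < 1 / Suc n"
    and \<delta>: "\<And>j n. 0 < \<delta> j n" "\<And>j n. \<delta> j n < 1 / Suc n"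
    and cov: "\<And>j n. ennreal_of_enat (covering_number (\<delta> j n) {x \<in> K j. Q n (r j n) x}) *
      ennreal (\<delta> j n powr (d + 1 / Suc n)) \<le> ennreal (1 / Suc n)"
    unfolding T_def by blast+
  define A where "A j m = (\<Inter>n\<in>{m..}. {x \<in> K j. Q n (r j n) x})" for j m
  show "lower_packing_measure s E = 0"
  proof (rule lower_packing_measure_eq_0I[of "range (\<lambda>(j, m). A j m)"])
    show "E \<subseteq> \<Union> (range (\<lambda>(j, m). A j m))"
    proof
      fix x assume x: "x \<in> E"
      then obtain j where j: "x \<in> K j"
        using E by blast
      obtain m where m: "\<And>n r. n \<ge> m \<Longrightarrow> 0 < r \<Longrightarrow> r < 1 / Suc n \<Longrightarrow> Q n r x"
        using lim[OF x] by blast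
      have "x \<in> A j m"
        using j m r by (auto simp: A_def)
      then show "x \<in> \<Union> (range (\<lambda>(j, m). A j m))"
        by auto
    qed
    fix B assume "B \<in> range (\<lambda>(j, m). A j m)"
    then obtain j m where B: "B = A j m"
      by auto
    show "lower_box_premeasure s B = 0"
    proof (rule lower_box_premeasure_eq_0I)
      fix e :: real assume "e > 0"
      \<comment> \<open>The level must bring both the cost 1/(n+1) below \<open>e\<close> and the
        exponent d + 1/(n+1) below \<open>s\<close>.\<close>
      then have "min e (s - d) > 0"
        using s by simp
      then obtain n\<^sub>0 where n0: "1 / Suc n\<^sub>0 < min e (s - d)"
        using nat_approx_posE by metis
      define n where "n = max m n\<^sub>0"
      have "1 / Suc n \<le> 1 / Suc n\<^sub>0"
        by (simp add: n_def frac_le)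
      then have n: "n \<ge> m" "1 / Suc n < e" "1 / Suc n < s - d"
        using n0 by (auto simp: n_def)
      have "covering_number (\<delta> j n) B \<le> covering_number (\<delta> j n) {x \<in> K j. Q n (r j n) x}"
        by (rule covering_number_mono) (use n(1) in \<open>auto simp: B A_def\<close>)
      \<comment> \<open>At scales below 1 the larger exponent gives the smaller power.\<close>
      moreover have "\<delta> j n powr s \<le> \<delta> j n powr (d + 1 / Suc n)"
      proof (rule powr_mono')
        have "1 / Suc n \<le> (1::real)"
          by simp
        then show "\<delta> j n \<le> 1"
          using \<delta>(2)[of j n] by linarith
      qed (use \<delta>(1)[of j n] n(3) in auto)
      ultimately have "ennreal_of_enat (covering_number (\<delta> j n) B) * ennreal (\<delta> j n powr s)
          \<le> ennreal_of_enat (covering_number (\<delta> j n) {x \<in> K j. Q n (r j n) x}) *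
            ennreal (\<delta> j n powr (d + 1 / Suc n))"
        by (intro mult_mono ennreal_leI) auto
      also have "\<dots> \<le> ennreal (1 / Suc n)"
        by (rule cov)
      also have "\<dots> \<le> ennreal e"
        using n(2) by (intro ennreal_leI) simp
      finally show "\<exists>\<delta>. 0 < \<delta> \<and> \<delta> < e \<and> ennreal_of_enat (covering_number \<delta> B) * ennreal (\<delta> powr s) \<le> ennreal e"
        using \<delta>[of j n] n(2) by (intro exI[of _ "\<delta> j n"]) auto
    qed
  qed auto
qed

lemma little_lip_pos_imp_oscillation:
  assumes \<phi>: "\<And>r. r > 0 \<Longrightarrow> \<phi> r > 0" and "little_lip \<phi> \<Omega> f x > 0"
  shows "\<exists>m. \<forall>n\<ge>m. \<forall>r. 0 < r \<longrightarrow> r < 1 / Suc n \<longrightarrow>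
    1 / Suc n * \<phi> r < diameter (f ` (cball x r \<inter> \<Omega>))"
proof -
  obtain c where c: "0 < ereal c" "ereal c < little_lip \<phi> \<Omega> f x"
    using ereal_dense2[OF assms(2)] by auto
  have "\<forall>\<^sub>F r in at_right 0. ereal c < ereal (diameter (f ` (cball x r \<inter> \<Omega>)) / \<phi> r)"
    using c(2) unfolding little_lip_def by (rule less_LiminfD)
  then obtain b where b: "b > 0" "\<And>r. 0 < r \<Longrightarrow> r < b \<Longrightarrow> c < diameter (f ` (cball x r \<inter> \<Omega>)) / \<phi> r"
    by (auto simp: eventually_at_right_field)
  \<comment> \<open>Below \<open>b\<close>, so that all radii under 1/(m+1) are admissible, and
    below \<open>c\<close>, so that the quotient exceeds the level.\<close>
  obtain m where m: "1 / Suc m < min b c"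
    using nat_approx_posE[of "min b c"] b(1) c(1) by auto
  show ?thesis
  proof (intro exI[of _ m] allI impI)
    fix n r assume n: "m \<le> n" and r: "0 < r" "r < 1 / Suc n"
    have nm: "1 / real (Suc n) \<le> 1 / Suc m"
      using n by (simp add: frac_le)
    then have "c < diameter (f ` (cball x r \<inter> \<Omega>)) / \<phi> r"
      using r m by (intro b(2)) auto
    then have "c * \<phi> r < diameter (f ` (cball x r \<inter> \<Omega>))"
      using \<phi>[OF r(1)] by (simp add: field_simps)
    moreover have "1 / Suc n * \<phi> r \<le> c * \<phi> r"
      using nm m \<phi>[OF r(1)] by (intro mult_right_mono) auto
    ultimately show "1 / Suc n * \<phi> r < diameter (f ` (cball x r \<inter> \<Omega>))"
      by linarith
  qed
qed

text \<open>The countably many conditions pair a compact piece of \<Omega> with a tolerance 1/(n+1);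
  \<open>exists_stable_small_oscillation\<close> shows each of them to be dense and stable.\<close>

lemma typically_lower_packing_dim_little_lip_pos_le:
  fixes \<Omega> :: "(real ^ 'd) set"
  assumes "\<And>r. r > 0 \<Longrightarrow> \<phi> r > 0" "locally compact \<Omega>"
  shows "typically_in (cont_funs \<Omega>) (\<lambda>f.
    lower_packing_dim {x \<in> \<Omega>. little_lip \<phi> \<Omega> f x > 0} \<le> of_nat (CARD('d) - 1))"
proof -
  obtain K :: "nat \<Rightarrow> (real ^ 'd) set" where K: "\<And>n. compact (K n)" "\<And>n. K n \<subseteq> \<Omega>" "\<Omega> = (\<Union>n. K n)"
    using locally_compact_sigma_compact[OF assms(2)] by blast
  define P where "P = (\<lambda>(j, n) (h :: real ^ 'd \<Rightarrow> real). \<exists>r \<delta>. 0 < r \<and> r < 1 / Suc n \<and> 0 < \<delta> \<and> \<delta> < 1 / Suc n \<and>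
        ennreal_of_enat (covering_number \<delta> {x \<in> K j. 1 / Suc n * \<phi> r < diameter (h ` (cball x r \<inter> \<Omega>))})
          * ennreal (\<delta> powr (real (CARD('d) - 1) + 1 / Suc n)) \<le> ennreal (1 / Suc n))"
  show ?thesis
  proof (rule typically_in_cont_funsI[where P = P and I = UNIV])
    fix i :: "nat \<times> nat" and f :: "real ^ 'd \<Rightarrow> real" and C and \<epsilon> :: real
    assume "continuous_on \<Omega> f" "compact C" "C \<subseteq> \<Omega>" "\<epsilon> > 0"
    then show "\<exists>g K' \<eta>. continuous_on \<Omega> g \<and> (\<forall>x\<in>C. \<bar>g x - f x\<bar> < \<epsilon>) \<and> compact K' \<and> K' \<subseteq> \<Omega> \<and> \<eta> > 0 \<and>
        (\<forall>h. continuous_on \<Omega> h \<longrightarrow> (\<forall>x\<in>K'. \<bar>h x - g x\<bar> < \<eta>) \<longrightarrow> P i h)"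
      using exists_stable_small_oscillation[OF assms K(1)[of "fst i"] K(2)[of "fst i"],
          where f = f and K = C and \<epsilon> = \<epsilon> and \<tau> = "1 / Suc (snd i)"]
      unfolding P_def by (simp only: split_def) simp
  next
    fix h assume "\<And>i. i \<in> UNIV \<Longrightarrow> P i h"
    then have P: "P (j, n) h" for j n
      by blast
    show "lower_packing_dim {x \<in> \<Omega>. little_lip \<phi> \<Omega> h x > 0} \<le> of_nat (CARD('d) - 1)"
    proof (rule lower_packing_dim_small_oscillation[of _ K
          "\<lambda>n r x. 1 / Suc n * \<phi> r < diameter (h ` (cball x r \<inter> \<Omega>))"])
      show "\<exists>m. \<forall>n\<ge>m. \<forall>r. 0 < r \<longrightarrow> r < 1 / Suc n \<longrightarrow> 1 / Suc n * \<phi> r < diameter (h ` (cball x r \<inter> \<Omega>))"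
        if "x \<in> {x \<in> \<Omega>. little_lip \<phi> \<Omega> h x > 0}" for x
        using little_lip_pos_imp_oscillation[of \<phi> \<Omega> h x] that assms(1) by simp
    qed (use K(3) P in \<open>auto simp only: P_def prod.case\<close>)
  qed simp
qed

section \<open>Steep perturbations\<close>

text \<open>The endpoints are rational so that countably many conditions suffice to iterate the
  passage to a subinterval.\<close>

definition steep_subcliff :: "(real \<Rightarrow> real) \<Rightarrow> real \<Rightarrow> real \<Rightarrow> nat \<Rightarrow> bool" where
  "steep_subcliff H a b n \<longleftrightarrow> (\<exists>a'\<in>\<rat>. \<exists>b'\<in>\<rat>. a \<le> a' \<and> a' < b' \<and> b' \<le> b \<and> b' - a' \<le> (b - a) / 2 \<and>
     Suc n * (b' - a') \<le> H b' - H a' \<and>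
     (n * (b - a) \<le> H b - H a \<longrightarrow>
       (\<forall>y\<in>{a'..b'}. \<forall>r\<in>{b' - a'..b - a}.
          \<exists>s\<in>{a..b}. \<exists>t\<in>{a..b}. \<bar>s - y\<bar> \<le> r \<and> \<bar>t - y\<bar> \<le> r \<and> n / 4 * r \<le> H t - H s)))"

text \<open>Take x minimizing H t - M t. While x + r stays in the interval, minimality yields the
  rise M r. Otherwise b is used: by minimality H x exceeds H a by at most M (b - a), so mean slope
  2M leaves a rise of at least M (b - a) \<ge> M r. The point does not depend on r.\<close>

lemma rise_point_exists:
  fixes H :: "real \<Rightarrow> real"
  assumes "a < b" "continuous_on {a..b} H" "0 \<le> M"
  obtains x where "x \<in> {a..b}"
    "\<And>r. 2 * M * (b - a) \<le> H b - H a \<Longrightarrow> 0 \<le> r \<Longrightarrow> r \<le> b - a \<Longrightarrow>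
      \<exists>t\<in>{x..b}. t \<le> x + r \<and> M * r \<le> H t - H x"
proof -
  let ?\<psi> = "\<lambda>t. H t - M * t"
  have "continuous_on {a..b} ?\<psi>"
    using assms(2) by (intro continuous_intros)
  then obtain x where x: "x \<in> {a..b}" "\<And>t. t \<in> {a..b} \<Longrightarrow> ?\<psi> x \<le> ?\<psi> t"
    using continuous_attains_inf[of "{a..b}" ?\<psi>] \<open>a < b\<close> by auto
  show thesis
  proof (rule that[OF x(1)])
    fix r assume slope: "2 * M * (b - a) \<le> H b - H a" and r: "0 \<le> r" "r \<le> b - a"
    show "\<exists>t\<in>{x..b}. t \<le> x + r \<and> M * r \<le> H t - H x"
    proof (cases "x + r \<le> b")
      case True
      then have "?\<psi> x \<le> ?\<psi> (x + r)"
        using x(1) r by (intro x(2)) auto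
      then show ?thesis
        using True r by (intro bexI[of _ "x + r"]) (auto simp: algebra_simps)
    next
      case False
      have "?\<psi> x \<le> ?\<psi> a"
        using \<open>a < b\<close> by (intro x(2)) auto
      then have "H x - H a \<le> M * (x - a)"
        by (simp add: algebra_simps)
      moreover have "M * r \<le> M * (b - a)" "M * (x - a) \<le> M * (b - a)"
        using assms(3) r x(1) by (auto intro!: mult_left_mono)
      moreover have "2 * (M * (b - a)) \<le> H b - H a"
        using slope by (simp add: mult.assoc)
      ultimately have "M * r \<le> H b - H x"
        by linarith
      then show ?thesis
        using False x(1) by (intro bexI[of _ b]) auto
    qed
  qed
qed

text \<open>The new interval is a rising half-period of the cosine, short compared with the rise it
  gains. Placing it in the period that contains the point from \<open>rise_point_exists\<close>
  keeps the oscillation large at all radii from its own length up to b - a.\<close>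

lemma cos_perturbation_steep_subcliff:
  fixes L n :: nat and a b w \<kappa> :: real
  assumes w_def: "w = (b - a) / L" and ab: "a < b" "a \<in> \<rat>" "b \<in> \<rat>" and L: "L > 0"
    and H: "continuous_on {a..b} H"
    and near: "\<And>t. t \<in> {a..b} \<Longrightarrow> \<bar>H t - (F t - \<kappa> * cos (2 * pi * L * (t - a) / (b - a)))\<bar> \<le> \<kappa> / 4"
    and F: "\<And>s t. s \<in> {a..b} \<Longrightarrow> t \<in> {a..b} \<Longrightarrow> \<bar>s - t\<bar> \<le> w \<Longrightarrow> \<bar>F s - F t\<bar> \<le> \<kappa> / 4"
    and w: "Suc n * w \<le> \<kappa>"
  shows "steep_subcliff H a b n"
proof -
  have w0: "w > 0" "L * w = b - a"
    using ab L by (auto simp: w_def)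
  \<comment> \<open>This \<open>x\<close> minimizes \<open>H t - (n/2) t\<close>. Only the slope of \<open>H\<close> itself enters, so the amplitude
    of the cosine does not spoil the oscillation at large radii.\<close>
  obtain x where x: "x \<in> {a..b}" "\<And>r. n * (b - a) \<le> H b - H a \<Longrightarrow>
      0 \<le> r \<Longrightarrow> r \<le> b - a \<Longrightarrow> \<exists>t\<in>{x..b}. t \<le> x + r \<and> n / 2 * r \<le> H t - H x"
    using rise_point_exists[OF ab(1) H, of "n / 2"] by auto
  have "\<exists>k<L. a + k * w \<le> x \<and> x \<le> a + Suc k * w"
  proof (cases "x = b")
    \<comment> \<open>The right endpoint is assigned to the last period; rounding down would give an
      index one too large.\<close>
    case True
    then show ?thesis
      using w0 L by (intro exI[of _ "L - 1"]) (auto simp: algebra_simps)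
  next
    case False
    define k where "k = nat \<lfloor>(x - a) / w\<rfloor>"
    have "0 \<le> (x - a) / w"
      using x(1) w0 by simp
    then have k: "real k \<le> (x - a) / w" "(x - a) / w < real k + 1"
      unfolding k_def by linarith+
    then have kw: "a + k * w \<le> x" "x \<le> a + Suc k * w"
      using w0(1) by (auto simp: field_simps)
    then have "k * w < L * w"
      using w0(2) False x(1) by auto
    then show ?thesis
      using kw w0(1) by auto
  qed
  then obtain k where k: "k < L" "a + k * w \<le> x" "x \<le> a + Suc k * w"
    by blast
  \<comment> \<open>The half-period of the cosine period containing \<open>x\<close> on which \<open>- cos\<close> rises.\<close>
  define a' b' where "a' = a + k * w" and "b' = a' + w / 2"
  have "Suc k * w \<le> L * w"
    using k(1) w0(1) by (intro mult_right_mono) auto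
  then have ab': "a \<le> a'" "a' < b'" "b' \<le> b" "a' + w \<le> b" "b' - a' = w / 2"
    using w0 by (auto simp: a'_def b'_def algebra_simps)
  then have mem: "a' \<in> {a..b}" "b' \<in> {a..b}"
    by auto
  have "1 * w \<le> L * w"
    using L w0(1) by (intro mult_right_mono) auto
  then have "w \<le> b - a"
    using w0(2) by simp
  have c: "cos (2 * pi * real k) = 1"
    using cos_2npi[of k] by (simp add: mult_ac)
  have "2 * pi * L * (a' - a) / (b - a) = 2 * pi * k"
    using ab(1) L by (simp add: a'_def w_def)
  then have ca: "cos (2 * pi * L * (a' - a) / (b - a)) = 1"
    using c by simp
  have "2 * pi * L * (b' - a) / (b - a) = 2 * pi * k + pi"
    using ab(1) L by (simp add: b'_def a'_def w_def field_simps)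
  then have cb: "cos (2 * pi * L * (b' - a) / (b - a)) = -1"
    using c by simp
  have "\<bar>F b' - F a'\<bar> \<le> \<kappa> / 4"
    using ab' w0(1) by (intro F mem) auto
  \<comment> \<open>The swing 2\<kappa> loses \<kappa>/4 to \<open>F\<close> and twice \<kappa>/4 to
    the distance of \<open>H\<close> from the model.\<close>
  then have rise: "\<kappa> \<le> H b' - H a'"
    using near[OF mem(1)] near[OF mem(2)] unfolding ca cb by linarith
  show ?thesis
    unfolding steep_subcliff_def
  proof (rule bexI[of _ a'], rule bexI[of _ b'], intro conjI impI ballI)
    have "w \<in> \<rat>"
      using ab(2,3) by (simp add: w_def)
    then show "a' \<in> \<rat>" "b' \<in> \<rat>"
      using ab(2) by (auto simp: a'_def b'_def)
    show "b' - a' \<le> (b - a) / 2"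
      using ab'(5) \<open>w \<le> b - a\<close> by simp
    have "Suc n * (b' - a') \<le> Suc n * w"
      using ab'(5) w0(1) by (intro mult_left_mono) auto
    then show "Suc n * (b' - a') \<le> H b' - H a'"
      using w rise by linarith
    fix y r assume slope: "n * (b - a) \<le> H b - H a" and y: "y \<in> {a'..b'}" and r: "r \<in> {b' - a'..b - a}"
    have xy: "\<bar>x - y\<bar> \<le> w"
      using y k ab'(5) w0(1) by (auto simp: a'_def algebra_simps abs_le_iff)
    show "\<exists>s\<in>{a..b}. \<exists>t\<in>{a..b}. \<bar>s - y\<bar> \<le> r \<and> \<bar>t - y\<bar> \<le> r \<and> n / 4 * r \<le> H t - H s"
    proof (cases "r \<ge> 2 * w")
      \<comment> \<open>From y it is at most w \<le> r/2 to x and another r/2 to t; slope n/2 over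
        length r/2 gives the rise n/4 * r.\<close>
      case True
      then have "0 \<le> r / 2" "r / 2 \<le> b - a"
        using w0(1) r by auto
      then obtain t where t: "t \<in> {x..b}" "t \<le> x + r / 2" "n / 2 * (r / 2) \<le> H t - H x"
        using x(2)[of "r / 2"] slope by auto
      then show ?thesis
        using x(1) xy True w0(1) by (intro bexI[of _ x] bexI[of _ t]) auto
    next
      \<comment> \<open>For shorter radii the new interval itself suffices: it lies within r of y
        and rises by at least (n + 1) w.\<close>
      case False
      then have "n / 4 * r \<le> n / 4 * (2 * w)"
        by (intro mult_left_mono) auto
      also have "\<dots> \<le> Suc n * w"
        using w0(1) by (simp add: algebra_simps)
      also have "\<dots> \<le> H b' - H a'"
        using w rise by linarith
      finally have "n / 4 * r \<le> H b' - H a'" .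
      then show ?thesis
        using y r mem by (intro bexI[of _ a'] bexI[of _ b']) auto
    qed
  qed (use ab' in auto)
qed

text \<open>Iteration gives nested intervals, the k-th of mean slope at least k for k > 0. Level k
  controls the radii between the lengths of intervals k + 1 and k, with constant k/4. These ranges
  abut, so every small radius around the common point is covered, with constants tending to
  infinity.\<close>

lemma steep_subcliffs_imp_steep_point:
  assumes ab: "a\<^sub>0 \<in> \<rat>" "b\<^sub>0 \<in> \<rat>" "a\<^sub>0 < b\<^sub>0"
    and steep: "\<And>a b n. a \<in> \<rat> \<Longrightarrow> b \<in> \<rat> \<Longrightarrow> a\<^sub>0 \<le> a \<Longrightarrow> a < b \<Longrightarrow> b \<le> b\<^sub>0 \<Longrightarrow> steep_subcliff H a b n"
  shows "\<exists>y\<in>{a\<^sub>0..b\<^sub>0}. \<forall>M. \<exists>\<delta>>0. \<forall>r. 0 < r \<longrightarrow> r < \<delta> \<longrightarrow>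
    (\<exists>s\<in>{a\<^sub>0..b\<^sub>0}. \<exists>t\<in>{a\<^sub>0..b\<^sub>0}. \<bar>s - y\<bar> \<le> r \<and> \<bar>t - y\<bar> \<le> r \<and> M * r \<le> H t - H s)"
proof -
  \<comment> \<open>The starting interval has no prescribed slope, whence the guard k > 0 here and
    in \<open>Q\<close>.\<close>
  define P where "P k p \<longleftrightarrow> (case p of (a, b) \<Rightarrow> a \<in> \<rat> \<and> b \<in> \<rat> \<and> a\<^sub>0 \<le> a \<and> a < b \<and> b \<le> b\<^sub>0 \<and>
    (k > 0 \<longrightarrow> k * (b - a) \<le> H b - H a))" for k :: nat and p :: "real \<times> real"
  define Q where "Q k p q \<longleftrightarrow> (case p of (a, b) \<Rightarrow> case q of (a', b') \<Rightarrow> a \<le> a' \<and> b' \<le> b \<and> b' - a' \<le> (b - a) / 2 \<and>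
    (k > 0 \<longrightarrow> (\<forall>y\<in>{a'..b'}. \<forall>r\<in>{b' - a'..b - a}.
      \<exists>s\<in>{a..b}. \<exists>t\<in>{a..b}. \<bar>s - y\<bar> \<le> r \<and> \<bar>t - y\<bar> \<le> r \<and> k / 4 * r \<le> H t - H s)))"
    for k :: nat and p q :: "real \<times> real"
  have "\<exists>p. P 0 p"
    using ab by (intro exI[of _ "(a\<^sub>0, b\<^sub>0)"]) (simp add: P_def)
  moreover have "\<exists>q. P (Suc k) q \<and> Q k p q" if "P k p" for k p
  proof -
    obtain a b where p: "p = (a, b)"
      by (cases p)
    have Pab: "a \<in> \<rat>" "b \<in> \<rat>" "a\<^sub>0 \<le> a" "a < b" "b \<le> b\<^sub>0" "k > 0 \<longrightarrow> k * (b - a) \<le> H b - H a"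
      using that by (auto simp: P_def p)
    then obtain a' b' :: real where ab': "a' \<in> \<rat>" "b' \<in> \<rat>" "a \<le> a'" "a' < b'" "b' \<le> b" "b' - a' \<le> (b - a) / 2"
      "Suc k * (b' - a') \<le> H b' - H a'"
      "k * (b - a) \<le> H b - H a \<longrightarrow> (\<forall>y\<in>{a'..b'}. \<forall>r\<in>{b' - a'..b - a}.
          \<exists>s\<in>{a..b}. \<exists>t\<in>{a..b}. \<bar>s - y\<bar> \<le> r \<and> \<bar>t - y\<bar> \<le> r \<and> k / 4 * r \<le> H t - H s)"
      using steep[of a b k] unfolding steep_subcliff_def by blast
    have "P (Suc k) (a', b')"
      unfolding P_def prod.case using ab' Pab by auto
    moreover have "Q k p (a', b')"
      unfolding Q_def prod.case p using ab'(3,5,6,8) Pab(6) by blast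
    ultimately show ?thesis
      by blast
  qed
  ultimately obtain p where p: "\<And>k. P k (p k)" "\<And>k. Q k (p k) (p (Suc k))"
    using dependent_nat_choice[of P Q] by blast
  define a b where "a k = fst (p k)" and "b k = snd (p k)" for k
  have ab_k: "a\<^sub>0 \<le> a k" "a k < b k" "b k \<le> b\<^sub>0" for k
    using p(1)[of k] by (auto simp: P_def a_def b_def split: prod.splits)
  have nest: "a k \<le> a (Suc k)" "b (Suc k) \<le> b k" "b (Suc k) - a (Suc k) \<le> (b k - a k) / 2" for k
    using p(2)[of k] by (auto simp: Q_def a_def b_def split: prod.splits)
  have osc: "\<exists>s\<in>{a k..b k}. \<exists>t\<in>{a k..b k}. \<bar>s - y\<bar> \<le> r \<and> \<bar>t - y\<bar> \<le> r \<and> k / 4 * r \<le> H t - H s"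
    if "k > 0" "y \<in> {a (Suc k)..b (Suc k)}" "r \<in> {b (Suc k) - a (Suc k)..b k - a k}" for k y r
    using p(2)[of k] that unfolding Q_def a_def b_def split_def by blast
  have mono: "{a j..b j} \<subseteq> {a i..b i}" if "i \<le> j" for i j
    using that
  proof (induction rule: dec_induct)
    case (step n)
    have "{a (Suc n)..b (Suc n)} \<subseteq> {a n..b n}"
      using nest(1,2)[of n] by auto
    then show ?case
      using step.IH by blast
  qed simp
  have "\<Inter>(range (\<lambda>k. {a k..b k})) \<noteq> {}"
    by (rule compact_nest) (use ab_k mono in \<open>auto simp: less_imp_le\<close>)
  then obtain y where y: "\<And>k. y \<in> {a k..b k}"
    by blast
  have len: "b k - a k \<le> (b 0 - a 0) * (1 / 2) ^ k" for k
  proof (induction k)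
    case (Suc k)
    then show ?case
      using nest(3)[of k] by simp
  qed simp
  show ?thesis
  proof (intro bexI[of _ y] allI)
    show "y \<in> {a\<^sub>0..b\<^sub>0}"
      using y[of 0] ab_k[of 0] by auto
    fix M :: real
    \<comment> \<open>At least 4M for the constant k/4, and at least 1 to be past the unconstrained
      first level.\<close>
    obtain k\<^sub>0 :: nat where k0: "max 1 (4 * M) \<le> k\<^sub>0"
      using real_arch_simple by blast
    show "\<exists>\<delta>>0. \<forall>r. 0 < r \<longrightarrow> r < \<delta> \<longrightarrow>
      (\<exists>s\<in>{a\<^sub>0..b\<^sub>0}. \<exists>t\<in>{a\<^sub>0..b\<^sub>0}. \<bar>s - y\<bar> \<le> r \<and> \<bar>t - y\<bar> \<le> r \<and> M * r \<le> H t - H s)"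
    proof (intro exI[of _ "b k\<^sub>0 - a k\<^sub>0"] conjI allI impI)
      show "0 < b k\<^sub>0 - a k\<^sub>0"
        using ab_k[of k\<^sub>0] by simp
      fix r :: real assume r: "0 < r" "r < b k\<^sub>0 - a k\<^sub>0"
      have "0 < r / (b 0 - a 0)"
        using r ab_k[of 0] by simp
      then obtain m where "(1 / 2) ^ m < r / (b 0 - a 0)"
        using real_arch_pow_inv[of _ "1/2"] by auto
      then have "(b 0 - a 0) * (1 / 2) ^ m < r"
        using ab_k[of 0] by (simp add: pos_less_divide_eq mult.commute)
      then have m: "b m - a m \<le> r"
        using len[of m] by linarith
      \<comment> \<open>The first interval of length at most r; its predecessor is longer than r,
        which places r in the range controlled by that predecessor's level.\<close>
      define k where "k = (LEAST k. b k - a k \<le> r)"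
      have k: "b k - a k \<le> r"
        unfolding k_def by (rule LeastI) (rule m)
      have "k\<^sub>0 < k"
      proof (rule ccontr)
        assume "\<not> k\<^sub>0 < k"
        then have "{a k\<^sub>0..b k\<^sub>0} \<subseteq> {a k..b k}"
          by (intro mono) simp
        then have "b k\<^sub>0 - a k\<^sub>0 \<le> b k - a k"
          using ab_k[of k\<^sub>0] by auto
        then show False
          using k r by simp
      qed
      then obtain j where j: "k = Suc j" "k\<^sub>0 \<le> j"
        by (cases k) auto
      have "\<not> b j - a j \<le> r"
        using not_less_Least[of j "\<lambda>k. b k - a k \<le> r"] j(1) by (simp add: k_def)
      then obtain s t where st: "s \<in> {a j..b j}" "t \<in> {a j..b j}" "\<bar>s - y\<bar> \<le> r" "\<bar>t - y\<bar> \<le> r"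
        "j / 4 * r \<le> H t - H s"
        using osc[of j y r] y k j k0 by force
      have "M \<le> j / 4"
        using k0 j(2) by simp
      then have "M * r \<le> j / 4 * r"
        using r(1) by (intro mult_right_mono) auto
      then show "\<exists>s\<in>{a\<^sub>0..b\<^sub>0}. \<exists>t\<in>{a\<^sub>0..b\<^sub>0}. \<bar>s - y\<bar> \<le> r \<and> \<bar>t - y\<bar> \<le> r \<and> M * r \<le> H t - H s"
        using st ab_k[of j] by (intro bexI[of _ s] bexI[of _ t]) auto
    qed
  qed
qed

section \<open>Infinite little lip function on a set with full shadow\<close>

lemma little_lip_eq_PInf:
  assumes bdd: "r\<^sub>1 > 0" "bounded (f ` (cball x r\<^sub>1 \<inter> \<Omega>))"
    and \<phi>: "\<And>r. r > 0 \<Longrightarrow> \<phi> r > 0" "C > 0" "\<forall>\<^sub>F r in at_right 0. \<phi> r \<le> C * r"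
    and steep: "\<And>M. \<exists>\<delta>>0. \<forall>r. 0 < r \<longrightarrow> r < \<delta> \<longrightarrow>
      (\<exists>s\<in>cball x r \<inter> \<Omega>. \<exists>t\<in>cball x r \<inter> \<Omega>. M * r \<le> f t - f s)"
  shows "little_lip \<phi> \<Omega> f x = \<infinity>"
proof (rule ereal_top)
  fix B :: real
  \<comment> \<open>Made nonnegative so that \<open>\<phi> r \<le> C * r\<close> can be multiplied
    by it.\<close>
  define M where "M = max B 0"
  obtain \<delta> where \<delta>: "\<delta> > 0" "\<And>r. 0 < r \<Longrightarrow> r < \<delta> \<Longrightarrow>
      \<exists>s\<in>cball x r \<inter> \<Omega>. \<exists>t\<in>cball x r \<inter> \<Omega>. M * C * r \<le> f t - f s"
    using steep[of "M * C"] by blast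
  have "\<forall>\<^sub>F r in at_right 0. 0 < r \<and> r < min \<delta> r\<^sub>1"
    using \<delta>(1) bdd(1) by (auto simp: eventually_at_right_field intro!: exI[of _ "min \<delta> r\<^sub>1"])
  with \<phi>(3) have "\<forall>\<^sub>F r in at_right 0. ereal B \<le> ereal (diameter (f ` (cball x r \<inter> \<Omega>)) / \<phi> r)"
  proof eventually_elim
    case (elim r)
    then obtain s t where st: "s \<in> cball x r \<inter> \<Omega>" "t \<in> cball x r \<inter> \<Omega>" "M * C * r \<le> f t - f s"
      using \<delta>(2)[of r] by auto
    have "cball x r \<inter> \<Omega> \<subseteq> cball x r\<^sub>1 \<inter> \<Omega>"
      using elim by auto
    \<comment> \<open>Boundedness makes the real-valued \<open>diameter\<close> dominate
      distances.\<close>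
    then have "bounded (f ` (cball x r \<inter> \<Omega>))"
      using bdd(2) by (meson bounded_subset image_mono)
    then have "dist (f t) (f s) \<le> diameter (f ` (cball x r \<inter> \<Omega>))"
      using st by (intro diameter_bounded_bound imageI)
    moreover have "M * \<phi> r \<le> M * (C * r)"
      using elim by (intro mult_left_mono) (auto simp: M_def)
    moreover have "B * \<phi> r \<le> M * \<phi> r"
      using \<phi>(1)[of r] elim by (intro mult_right_mono) (auto simp: M_def)
    ultimately have "B * \<phi> r \<le> diameter (f ` (cball x r \<inter> \<Omega>))"
      using st(3) by (simp add: dist_real_def mult.assoc)
    then show ?case
      using \<phi>(1)[of r] elim by (simp add: pos_le_divide_eq)
  qed
  then show "ereal B \<le> little_lip \<phi> \<Omega> f x"
    unfolding little_lip_def by (rule Liminf_bounded)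
qed

text \<open>The added cosine depends on the coordinate \<open>i\<^sub>0\<close> alone, so one
  perturbation acts alike on all segments parallel to this axis, and uniform continuity on the cube
  supplies one frequency for all of them. The tolerance \<kappa>/4 in
  \<open>cos_perturbation_steep_subcliff\<close> makes the effect stable.\<close>

lemma exists_stable_steep_subcliff:
  fixes \<Omega> :: "(real ^ 'd) set" and c :: "real ^ 'd" and \<rho> \<epsilon> a b :: real and f :: "real ^ 'd \<Rightarrow> real"
  defines "Q \<equiv> cbox c (\<chi> i. c $ i + \<rho>)"
  assumes "Q \<subseteq> \<Omega>" and f: "continuous_on \<Omega> f" and "\<epsilon> > 0"
    and ab: "a \<in> \<rat>" "b \<in> \<rat>" "0 \<le> a" "a < b" "b \<le> \<rho>"
  shows "\<exists>g \<eta>. continuous_on \<Omega> g \<and> (\<forall>x. \<bar>g x - f x\<bar> < \<epsilon>) \<and> \<eta> > 0 \<and>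
    (\<forall>h. continuous_on \<Omega> h \<longrightarrow> (\<forall>x\<in>Q. \<bar>h x - g x\<bar> < \<eta>) \<longrightarrow>
      (\<forall>u\<in>Q. u $ i\<^sub>0 = c $ i\<^sub>0 \<longrightarrow> steep_subcliff (\<lambda>t. h (u + t *\<^sub>R axis i\<^sub>0 1)) a b n))"
proof -
  define \<kappa> where "\<kappa> = \<epsilon> / 2"
  have "\<kappa> > 0"
    using \<open>\<epsilon> > 0\<close> by (simp add: \<kappa>_def)
  have "uniformly_continuous_on Q f"
    by (rule compact_uniformly_continuous)
      (use f \<open>Q \<subseteq> \<Omega>\<close> continuous_on_subset in \<open>auto simp: Q_def\<close>)
  moreover have "\<kappa> / 4 > 0"
    using \<open>\<kappa> > 0\<close> by simp
  ultimately obtain e where e: "e > 0" "\<forall>x\<in>Q. \<forall>y\<in>Q. dist y x < e \<longrightarrow> dist (f y) (f x) < \<kappa> / 4"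
    unfolding uniformly_continuous_on_def by blast
  have lim: "(\<lambda>L. a / real L) \<longlonglongrightarrow> 0" for a :: real
    by (rule lim_const_over_n)
  \<comment> \<open>The period (b - a)/L must be below \<open>e\<close>, so that \<open>f\<close>
    varies by less than \<kappa>/4 over it, and n + 1 times the period must be below
    \<kappa>.\<close>
  have "\<forall>\<^sub>F L in sequentially. 0 < L \<and> (b - a) / real L < e \<and> (Suc n * (b - a)) / real L < \<kappa>"
    using eventually_gt_at_top[of 0] order_tendstoD(2)[OF lim e(1)] order_tendstoD(2)[OF lim \<open>\<kappa> > 0\<close>]
    by (intro eventually_conj)
  then obtain L where L: "0 < L" "(b - a) / real L < e" "(Suc n * (b - a)) / real L < \<kappa>"
    by (auto dest: eventually_happens)
  define g where "g x = f x - \<kappa> * cos (2 * pi * L * (x $ i\<^sub>0 - c $ i\<^sub>0 - a) / (b - a))" for x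
  have line: "u + t *\<^sub>R axis i\<^sub>0 1 \<in> Q" if "u \<in> Q" "u $ i\<^sub>0 = c $ i\<^sub>0" "t \<in> {a..b}" for u t
    using that ab unfolding Q_def mem_box_cart by (auto simp: axis_def)
  have "steep_subcliff (\<lambda>t. h (u + t *\<^sub>R axis i\<^sub>0 1)) a b n"
    if h: "continuous_on \<Omega> h" "\<forall>x\<in>Q. \<bar>h x - g x\<bar> < \<kappa> / 4" and u: "u \<in> Q" "u $ i\<^sub>0 = c $ i\<^sub>0" for h u
  proof (rule cos_perturbation_steep_subcliff[OF refl ab(4,1,2) L(1), where F = "\<lambda>t. f (u + t *\<^sub>R axis i\<^sub>0 1)" and \<kappa> = \<kappa>])
    show "continuous_on {a..b} (\<lambda>t. h (u + t *\<^sub>R axis i\<^sub>0 1))"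
      by (rule continuous_on_compose2[OF h(1)]) (use line u \<open>Q \<subseteq> \<Omega>\<close> in \<open>auto intro!: continuous_intros\<close>)
    show "\<bar>h (u + t *\<^sub>R axis i\<^sub>0 1) - (f (u + t *\<^sub>R axis i\<^sub>0 1) - \<kappa> * cos (2 * pi * L * (t - a) / (b - a)))\<bar> \<le> \<kappa> / 4"
      if "t \<in> {a..b}" for t
      using bspec[OF h(2) line[OF u that]] u(2) by (simp add: g_def axis_def less_imp_le)
    show "\<bar>f (u + s *\<^sub>R axis i\<^sub>0 1) - f (u + t *\<^sub>R axis i\<^sub>0 1)\<bar> \<le> \<kappa> / 4"
      if st: "s \<in> {a..b}" "t \<in> {a..b}" "\<bar>s - t\<bar> \<le> (b - a) / L" for s t
    proof -
      have "dist (u + s *\<^sub>R axis i\<^sub>0 1) (u + t *\<^sub>R axis i\<^sub>0 1) = norm ((s - t) *\<^sub>R (axis i\<^sub>0 1 :: real ^ 'd))"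
        by (simp add: dist_norm scaleR_diff_left)
      also have "\<dots> < e"
        using st(3) L(2) by simp
      finally have "dist (f (u + s *\<^sub>R axis i\<^sub>0 1)) (f (u + t *\<^sub>R axis i\<^sub>0 1)) < \<kappa> / 4"
        using e(2) line[OF u st(1)] line[OF u st(2)] by blast
      then show ?thesis
        by (simp add: dist_real_def)
    qed
  qed (use L(3) in simp)
  moreover have "continuous_on \<Omega> g"
    unfolding g_def using f ab(4) by (intro continuous_intros) auto
  moreover have "\<bar>g x - f x\<bar> < \<epsilon>" for x
  proof -
    have "\<bar>g x - f x\<bar> = \<kappa> * \<bar>cos (2 * pi * L * (x $ i\<^sub>0 - c $ i\<^sub>0 - a) / (b - a))\<bar>"
      using \<open>\<kappa> > 0\<close> by (simp add: g_def abs_mult)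
    also have "\<dots> \<le> \<kappa> * 1"
      using \<open>\<kappa> > 0\<close> by (intro mult_left_mono abs_cos_le_one) simp
    finally show ?thesis
      using \<open>\<epsilon> > 0\<close> by (simp add: \<kappa>_def)
  qed
  ultimately show ?thesis
    using \<open>\<kappa> / 4 > 0\<close> by (intro exI[of _ g] exI[of _ "\<kappa> / 4"]) blast
qed

text \<open>Each condition, indexed by a slope and a rational interval, concerns all segments of a
  cube at once. Countably many conditions therefore give a point of infinite little lip on every
  segment, uncountably many though the segments may be, and these points have full shadow.\<close>

lemma typically_hausdorff_dim_little_lip_PInf_ge:
  fixes \<Omega> :: "(real ^ 'd) set"
  assumes \<phi>: "\<And>r. r > 0 \<Longrightarrow> \<phi> r > 0" "C > 0" "\<forall>\<^sub>F r in at_right 0. \<phi> r \<le> C * r"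
    and "locally compact \<Omega>" "interior \<Omega> \<noteq> {}"
  shows "typically_in (cont_funs \<Omega>) (\<lambda>f.
    of_nat (CARD('d) - 1) \<le> hausdorff_dim {x \<in> \<Omega>. little_lip \<phi> \<Omega> f x = \<infinity>})"
proof -
  obtain c e where c: "e > 0" "ball c e \<subseteq> \<Omega>"
    using assms(5) by (auto simp: mem_interior)
  obtain m where m: "1 / Suc m < e / CARD('d)"
    using nat_approx_posE[of "e / CARD('d)"] c(1) by auto
  \<comment> \<open>A rational side makes the full segment [0, \<rho>] one of the indexed intervals;
    the division by d in the choice of m pays for bounding the norm by the sum of
    coordinates.\<close>
  define \<rho> where "\<rho> = 1 / real (Suc m)"
  have \<rho>: "\<rho> > 0" "\<rho> \<in> \<rat>" "CARD('d) * \<rho> < e"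
    using m by (auto simp: \<rho>_def field_simps)
  define Q where "Q = cbox c (\<chi> i. c $ i + \<rho>)"
  have "Q \<subseteq> \<Omega>"
  proof
    fix x assume x: "x \<in> Q"
    have "dist c x \<le> (\<Sum>i\<in>UNIV. \<bar>(c - x) $ i\<bar>)"
      unfolding dist_norm by (rule norm_le_l1_cart)
    also have "\<dots> \<le> (\<Sum>i\<in>(UNIV::'d set). \<rho>)"
      using x by (intro sum_mono) (auto simp: Q_def mem_box_cart abs_le_iff algebra_simps)
    also have "\<dots> < e"
      using \<rho>(3) by simp
    finally show "x \<in> \<Omega>"
      using c(2) by auto
  qed
  obtain i\<^sub>0 :: 'd where True
    by simp
  define P where "P = (\<lambda>(n, a, b) (h :: real ^ 'd \<Rightarrow> real). \<forall>u\<in>Q. u $ i\<^sub>0 = c $ i\<^sub>0 \<longrightarrow>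
    steep_subcliff (\<lambda>t. h (u + t *\<^sub>R axis i\<^sub>0 1)) a b n)"
  define I where "I = {(n :: nat, a :: real, b :: real). a \<in> \<rat> \<and> b \<in> \<rat> \<and> 0 \<le> a \<and> a < b \<and> b \<le> \<rho>}"
  show ?thesis
  proof (rule typically_in_cont_funsI[where I = I and P = P])
    have "I \<subseteq> UNIV \<times> \<rat> \<times> \<rat>"
      by (auto simp: I_def)
    then show "countable I"
      by (rule countable_subset) (intro countable_SIGMA countable_rat, simp)
  next
    fix i and f :: "real ^ 'd \<Rightarrow> real" and K and \<epsilon> :: real
    assume i: "i \<in> I" and f: "continuous_on \<Omega> f" and "\<epsilon> > 0"
    obtain n a b where nab: "i = (n, a, b)" "a \<in> \<rat>" "b \<in> \<rat>" "0 \<le> a" "a < b" "b \<le> \<rho>"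
      using i by (auto simp: I_def)
    obtain g \<eta> where g: "continuous_on \<Omega> g" "\<forall>x. \<bar>g x - f x\<bar> < \<epsilon>" "\<eta> > 0"
      "\<forall>h. continuous_on \<Omega> h \<longrightarrow> (\<forall>x\<in>Q. \<bar>h x - g x\<bar> < \<eta>) \<longrightarrow> P i h"
      using exists_stable_steep_subcliff[OF \<open>Q \<subseteq> \<Omega>\<close>[unfolded Q_def] f \<open>\<epsilon> > 0\<close> nab(2-6), of i\<^sub>0 n]
      unfolding P_def nab(1) prod.case Q_def by blast
    moreover have "compact Q"
      by (simp add: Q_def)
    ultimately show "\<exists>g K' \<eta>. continuous_on \<Omega> g \<and> (\<forall>x\<in>K. \<bar>g x - f x\<bar> < \<epsilon>) \<and> compact K' \<and> K' \<subseteq> \<Omega> \<and> \<eta> > 0 \<and>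
        (\<forall>h. continuous_on \<Omega> h \<longrightarrow> (\<forall>x\<in>K'. \<bar>h x - g x\<bar> < \<eta>) \<longrightarrow> P i h)"
      using \<open>Q \<subseteq> \<Omega>\<close> by (intro exI[of _ g] exI[of _ Q] exI[of _ \<eta>]) simp
  next
    fix h assume h: "continuous_on \<Omega> h" and P: "\<And>i. i \<in> I \<Longrightarrow> P i h"
    let ?E = "{x \<in> \<Omega>. little_lip \<phi> \<Omega> h x = \<infinity>}"
    have shadow: "\<exists>x\<in>?E. \<forall>i. i \<noteq> i\<^sub>0 \<longrightarrow> x $ i = u $ i"
      if u: "\<And>i. c $ i \<le> u $ i \<and> u $ i \<le> c $ i + \<rho>" for u
    proof -
      \<comment> \<open>\<open>v\<close> is \<open>u\<close> moved to the base face; the segment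
        through it in direction \<open>i\<^sub>0\<close> keeps the other coordinates of
        \<open>u\<close>.\<close>
      define v where "v = (\<chi> i. if i = i\<^sub>0 then c $ i else u $ i)"
      have v: "v \<in> Q" "v $ i\<^sub>0 = c $ i\<^sub>0"
        using u \<rho>(1) by (auto simp: v_def Q_def mem_box_cart)
      define \<gamma> where "\<gamma> t = v + t *\<^sub>R axis i\<^sub>0 1" for t
      have \<gamma>: "\<gamma> t \<in> \<Omega>" if "t \<in> {0..\<rho>}" for t
      proof -
        have "\<gamma> t \<in> Q"
          using that v \<rho>(1) by (auto simp: \<gamma>_def Q_def mem_box_cart axis_def)
        then show ?thesis
          using \<open>Q \<subseteq> \<Omega>\<close> by blast
      qed
      have dist_\<gamma>: "dist (\<gamma> y) (\<gamma> s) = \<bar>s - y\<bar>" for y s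
      proof -
        have "dist (\<gamma> y) (\<gamma> s) = norm ((y - s) *\<^sub>R (axis i\<^sub>0 1 :: real ^ 'd))"
          by (simp add: \<gamma>_def dist_norm scaleR_diff_left)
        then show ?thesis
          by (simp add: abs_minus_commute)
      qed
      have "steep_subcliff (\<lambda>t. h (\<gamma> t)) a b n"
        if "a \<in> \<rat>" "b \<in> \<rat>" "0 \<le> a" "a < b" "b \<le> \<rho>" for a b n
        using P[of "(n, a, b)"] that v by (simp add: I_def P_def \<gamma>_def)
      from steep_subcliffs_imp_steep_point[OF Rats_0 \<rho>(2,1) this]
      obtain y where y: "y \<in> {0..\<rho>}" "\<And>M. \<exists>\<delta>>0. \<forall>r. 0 < r \<longrightarrow> r < \<delta> \<longrightarrow>
        (\<exists>s\<in>{0..\<rho>}. \<exists>t\<in>{0..\<rho>}. \<bar>s - y\<bar> \<le> r \<and> \<bar>t - y\<bar> \<le> r \<and> M * r \<le> h (\<gamma> t) - h (\<gamma> s))"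
        by blast
      obtain r\<^sub>1 K where K: "r\<^sub>1 > 0" "compact K" "K \<subseteq> \<Omega>" "cball (\<gamma> y) r\<^sub>1 \<inter> \<Omega> \<subseteq> K"
        using locally_compact_compact_thickening[OF assms(4), of "{\<gamma> y}"] \<gamma>[OF y(1)] by auto
      have "compact (h ` K)"
        using K h by (intro compact_continuous_image) (auto intro: continuous_on_subset)
      then have bdd: "bounded (h ` (cball (\<gamma> y) r\<^sub>1 \<inter> \<Omega>))"
        using K(4) by (meson bounded_subset compact_imp_bounded image_mono)
      have "little_lip \<phi> \<Omega> h (\<gamma> y) = \<infinity>"
      proof (rule little_lip_eq_PInf[OF K(1) bdd \<phi>])
        fix M :: real
        obtain \<delta> where \<delta>: "\<delta> > 0" "\<And>r. 0 < r \<Longrightarrow> r < \<delta> \<Longrightarrow>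
          \<exists>s\<in>{0..\<rho>}. \<exists>t\<in>{0..\<rho>}. \<bar>s - y\<bar> \<le> r \<and> \<bar>t - y\<bar> \<le> r \<and> M * r \<le> h (\<gamma> t) - h (\<gamma> s)"
          using y(2)[of M] by blast
        have "\<exists>s\<in>cball (\<gamma> y) r \<inter> \<Omega>. \<exists>t\<in>cball (\<gamma> y) r \<inter> \<Omega>. M * r \<le> h t - h s"
          if r: "0 < r" "r < \<delta>" for r
        proof -
          obtain s t where st: "s \<in> {0..\<rho>}" "t \<in> {0..\<rho>}" "\<bar>s - y\<bar> \<le> r" "\<bar>t - y\<bar> \<le> r"
            "M * r \<le> h (\<gamma> t) - h (\<gamma> s)"
            using \<delta>(2)[OF r] by blast
          have "\<gamma> s \<in> cball (\<gamma> y) r \<inter> \<Omega>" "\<gamma> t \<in> cball (\<gamma> y) r \<inter> \<Omega>"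
            using st(3,4) \<gamma>[OF st(1)] \<gamma>[OF st(2)] by (simp_all add: dist_\<gamma>)
          then show ?thesis
            using st(5) by blast
        qed
        then show "\<exists>\<delta>>0. \<forall>r. 0 < r \<longrightarrow> r < \<delta> \<longrightarrow>
          (\<exists>s\<in>cball (\<gamma> y) r \<inter> \<Omega>. \<exists>t\<in>cball (\<gamma> y) r \<inter> \<Omega>. M * r \<le> h t - h s)"
          using \<delta>(1) by blast
      qed auto
      moreover have "\<gamma> y $ i = u $ i" if "i \<noteq> i\<^sub>0" for i
        using that by (simp add: \<gamma>_def v_def axis_def)
      ultimately show ?thesis
        using \<gamma>[OF y(1)] by (intro bexI[of _ "\<gamma> y"]) auto
    qed
    have "hausdorff_measure (real (CARD('d) - 1)) ?E > 0" if "real (CARD('d) - 1) > 0"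
      using that by (intro hausdorff_measure_pos_if_shadow[OF \<rho>(1) _ shadow]) auto
    then have "ennreal (real (CARD('d) - 1)) \<le> hausdorff_dim ?E"
      by (intro hausdorff_dim_ge) auto
    then show "of_nat (CARD('d) - 1) \<le> hausdorff_dim ?E"
      by (simp add: ennreal_of_nat_eq_real_of_nat)
  qed
qed

section \<open>Assembly of the upper and lower bounds\<close>

theorem theorem3p5:
  fixes \<phi> :: "real \<Rightarrow> real" and \<Omega> :: "(real ^ 'd) set"
  assumes "gauge_function \<phi>" and "locally compact \<Omega>"
  shows "typically_in (cont_funs \<Omega>) (\<lambda>f.
           lower_packing_dim {x \<in> \<Omega>. little_lip \<phi> \<Omega> f x > 0} \<le> of_nat (CARD('d) - 1))
       \<and> (interior \<Omega> \<noteq> {} \<and> Limsup (at_right 0) (\<lambda>r. ereal (\<phi> r / r)) < \<infinity> \<longrightarrow>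
           typically_in (cont_funs \<Omega>) (\<lambda>f.
             lower_packing_dim {x \<in> \<Omega>. little_lip \<phi> \<Omega> f x > 0} = of_nat (CARD('d) - 1) \<and>
             hausdorff_dim {x \<in> \<Omega>. little_lip \<phi> \<Omega> f x > 0} = of_nat (CARD('d) - 1) \<and>
             lower_packing_dim {x \<in> \<Omega>. little_lip \<phi> \<Omega> f x = \<infinity>} = of_nat (CARD('d) - 1) \<and>
             hausdorff_dim {x \<in> \<Omega>. little_lip \<phi> \<Omega> f x = \<infinity>} = of_nat (CARD('d) - 1)))"
proof (intro conjI impI)
  have pos: "\<And>r. r > 0 \<Longrightarrow> \<phi> r > 0"
    using assms(1) by (auto simp: gauge_function_def)
  show upper: "typically_in (cont_funs \<Omega>) (\<lambda>f.
      lower_packing_dim {x \<in> \<Omega>. little_lip \<phi> \<Omega> f x > 0} \<le> of_nat (CARD('d) - 1))"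
    using pos assms(2) by (rule typically_lower_packing_dim_little_lip_pos_le)
  assume *: "interior \<Omega> \<noteq> {} \<and> Limsup (at_right 0) (\<lambda>r. ereal (\<phi> r / r)) < \<infinity>"
  then obtain C\<^sub>0 where "Limsup (at_right 0) (\<lambda>r. ereal (\<phi> r / r)) < ereal C\<^sub>0"
    using ereal_dense2 by blast
  then have "\<forall>\<^sub>F r in at_right 0. ereal (\<phi> r / r) < ereal C\<^sub>0"
    by (rule Limsup_lessD)
  \<comment> \<open>The maximum with 1 makes the constant positive and only weakens the
    bound.\<close>
  with eventually_at_right_less[of 0] have C: "\<forall>\<^sub>F r in at_right 0. \<phi> r \<le> max C\<^sub>0 1 * r"
  proof eventually_elim
    case (elim r)
    then have "\<phi> r \<le> C\<^sub>0 * r"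
      by (simp add: pos_divide_less_eq)
    also have "\<dots> \<le> max C\<^sub>0 1 * r"
      using elim by (intro mult_right_mono) auto
    finally show ?case .
  qed
  have "typically_in (cont_funs \<Omega>) (\<lambda>f.
      of_nat (CARD('d) - 1) \<le> hausdorff_dim {x \<in> \<Omega>. little_lip \<phi> \<Omega> f x = \<infinity>})"
    using * by (intro typically_hausdorff_dim_little_lip_PInf_ge[OF pos _ C assms(2)]) auto
  from typically_in_conj[OF upper this]
  show "typically_in (cont_funs \<Omega>) (\<lambda>f.
      lower_packing_dim {x \<in> \<Omega>. little_lip \<phi> \<Omega> f x > 0} = of_nat (CARD('d) - 1) \<and>
      hausdorff_dim {x \<in> \<Omega>. little_lip \<phi> \<Omega> f x > 0} = of_nat (CARD('d) - 1) \<and>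
      lower_packing_dim {x \<in> \<Omega>. little_lip \<phi> \<Omega> f x = \<infinity>} = of_nat (CARD('d) - 1) \<and>
      hausdorff_dim {x \<in> \<Omega>. little_lip \<phi> \<Omega> f x = \<infinity>} = of_nat (CARD('d) - 1))"
  proof (rule typically_in_mono)
    fix f
    let ?P = "{x \<in> \<Omega>. little_lip \<phi> \<Omega> f x > 0}" and ?I = "{x \<in> \<Omega>. little_lip \<phi> \<Omega> f x = \<infinity>}"
    assume bounds: "lower_packing_dim ?P \<le> of_nat (CARD('d) - 1) \<and> of_nat (CARD('d) - 1) \<le> hausdorff_dim ?I"
    \<comment> \<open>All four dimensions lie between \<open>hausdorff_dim ?I\<close> and
      \<open>lower_packing_dim ?P\<close>, by monotonicity and the comparison of the two dimensions;
      the bounds put the former at or above d - 1 and the latter at or below it.\<close>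
    have "?I \<subseteq> ?P"
      by auto
    then have "hausdorff_dim ?I \<le> hausdorff_dim ?P" "lower_packing_dim ?I \<le> lower_packing_dim ?P"
      by (rule hausdorff_dim_mono lower_packing_dim_mono)+
    with bounds hausdorff_dim_le_lower_packing_dim[of ?P] hausdorff_dim_le_lower_packing_dim[of ?I]
    show "lower_packing_dim ?P = of_nat (CARD('d) - 1) \<and> hausdorff_dim ?P = of_nat (CARD('d) - 1) \<and>
      lower_packing_dim ?I = of_nat (CARD('d) - 1) \<and> hausdorff_dim ?I = of_nat (CARD('d) - 1)"
      by (meson antisym order_trans)
  qed
qed

end
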